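(* Let $\mathbb{L}_1,\mathbb{L}_2$ be fields with $\mathrm{Char}\,\mathbb{L}_1=\mathrm{Char}\,\mathbb{L}_2=0$ such that, for all $n$, the only ring homomorphism from $\mathbb{L}_1$ to the ring $\mathrm{M}_n(\mathbb{L}_2)$ of $n\times n$ matrices over $\mathbb{L}_2$ is the trivial zero homomorphism. Let $U$ and $\widetilde{U}$ be unipotent algebraic groups over the fields $\mathbb{L}_1$ and $\mathbb{L}_2$, respectively. Then for any abstract homomorphism $\phi: U(\mathbb{L}_1)\to\widetilde{U}(\mathbb{L}_2)$ the image $\phi(U(\mathbb{L}_1))$ is abelian.
   Context: Algebraic groups are linear algebraic groups. For an algebraic group $A$ defined over a field $\mathbb{L}$, $A(\mathbb{L})$ is its group of $\mathbb{L}$-rational points. An abstract homomorphism is a homomorphism of abstract groups (no continuity or algebraicity assumed). Ring homomorphisms are not required to preserve the identity element. *)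

theory Defs
  imports
    "Jordan_Normal_Form.Matrix"
    "HOL-Algebra.Algebraic_Closure_Type"
    "HOL-Library.Poly_Mapping"
begin

definition GL :: "nat \<Rightarrow> 'k::comm_ring_1 mat monoid" where
  "GL n = units_of (ring_mat TYPE('k) n ())"

lemma group_GL: "group (GL n :: 'k::comm_ring_1 mat monoid)"
proof -
  interpret R: ring "ring_mat TYPE('k) n ()" by (rule ring_mat)
  show ?thesis unfolding GL_def by (rule R.units_group)
qed


section \<open>Polynomials in matrix entries\<close>

text \<open>The variable \<open>(i, j)\<close> stands for the matrix entry in row \<open>i\<close> and column \<open>j\<close>, so that
  \<open>entry_polys n\<close> is the polynomial ring in the \<open>n * n\<close> variables with \<open>i, j < n\<close>.\<close>

type_synonym 'k entry_poly = "((nat \<times> nat) \<Rightarrow>\<^sub>0 nat) \<Rightarrow>\<^sub>0 'k"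

definition entry_polys :: "nat \<Rightarrow> 'k::comm_ring_1 entry_poly set" where
  "entry_polys n =
     {p. \<forall>m \<in> Poly_Mapping.keys p. Poly_Mapping.keys m \<subseteq> {..<n} \<times> {..<n}}"

definition eval_entries :: "'k::comm_ring_1 entry_poly \<Rightarrow> 'k mat \<Rightarrow> 'k" where
  "eval_entries p A =
     (\<Sum>m \<in> Poly_Mapping.keys p. Poly_Mapping.lookup p m *
        (\<Prod>v \<in> Poly_Mapping.keys m. (A $$ v) ^ Poly_Mapping.lookup m v))"

definition coeffs_in_base :: "'a::field alg_closure entry_poly \<Rightarrow> bool" where
  "coeffs_in_base p \<longleftrightarrow> (\<forall>m. Poly_Mapping.lookup p m \<in> range to_ac)"


section \<open>Linear algebraic groups over a field\<close>

text \<open>A linear algebraic group over a field \<open>'a\<close> is a Zariski closed subgroup of \<open>GL n\<close> over the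
  algebraic closure of \<open>'a\<close> which is defined over \<open>'a\<close>. The set \<open>U\<close> below is its group of points
  over the algebraic closure.\<close>

definition zariski_closed :: "nat \<Rightarrow> 'k::field mat set \<Rightarrow> bool" where
  "zariski_closed n U \<longleftrightarrow>
     (\<exists>S \<subseteq> entry_polys n. U = {A \<in> carrier (GL n). \<forall>p \<in> S. eval_entries p A = 0})"

definition vanishing_ideal :: "nat \<Rightarrow> 'k::field mat set \<Rightarrow> 'k entry_poly set" where
  "vanishing_ideal n U = {p \<in> entry_polys n. \<forall>A \<in> U. eval_entries p A = 0}"

text \<open>The vanishing ideal is generated, as an ideal of \<open>entry_polys n\<close>, by its members with
  coefficients in the base field.\<close>

definition defined_over_base :: "nat \<Rightarrow> 'a::field alg_closure mat set \<Rightarrow> bool" where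
  "defined_over_base n U \<longleftrightarrow>
     (\<forall>p \<in> vanishing_ideal n U. \<exists>T q.
        finite T \<and> T \<subseteq> {s \<in> vanishing_ideal n U. coeffs_in_base s} \<and>
        q ` T \<subseteq> entry_polys n \<and> p = (\<Sum>s \<in> T. q s * s))"

definition linear_algebraic_group :: "nat \<Rightarrow> 'a::field alg_closure mat set \<Rightarrow> bool" where
  "linear_algebraic_group n U \<longleftrightarrow>
     subgroup U (GL n) \<and> zariski_closed n U \<and> defined_over_base n U"

definition unipotent_mat :: "nat \<Rightarrow> 'k::comm_ring_1 mat \<Rightarrow> bool" where
  "unipotent_mat n A \<longleftrightarrow> A \<in> carrier_mat n n \<and> (\<exists>k. (A - 1\<^sub>m n) ^\<^sub>m k = 0\<^sub>m n n)"

definition unipotent_algebraic_group :: "nat \<Rightarrow> 'a::field alg_closure mat set \<Rightarrow> bool" where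
  "unipotent_algebraic_group n U \<longleftrightarrow>
     linear_algebraic_group n U \<and> (\<forall>A \<in> U. unipotent_mat n A)"

definition rational_points :: "nat \<Rightarrow> 'a::field alg_closure mat set \<Rightarrow> 'a mat monoid" where
  "rational_points n U = (GL n)\<lparr>carrier := {A \<in> carrier (GL n). map_mat to_ac A \<in> U}\<rparr>"


section \<open>Ring homomorphisms into matrix rings\<close>

text \<open>Not required to be unital, in contrast to \<^const>\<open>ring_hom\<close>.\<close>

definition nonunital_ring_hom_mat :: "nat \<Rightarrow> ('a::ring_1 \<Rightarrow> 'b::ring_1 mat) \<Rightarrow> bool" where
  "nonunital_ring_hom_mat n f \<longleftrightarrow>
     (\<forall>x. f x \<in> carrier_mat n n) \<and>
     (\<forall>x y. f (x + y) = f x + f y) \<and>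
     (\<forall>x y. f (x * y) = f x * f y)"

end

theory Submission
  imports Defs "HOL-Library.Product_Plus" "Jordan_Normal_Form.Determinant"
begin

text \<open>
Points of a unipotent group have logarithms, given by finite series, and two points commute as soon
as their logarithms do. Let \<open>D\<close> be the map induced by \<open>\<phi>\<close> on logarithms, so that
\<open>\<phi> (exp x) = exp (D x)\<close>. The proof compares the Lie algebra structures on both sides.

The graph of \<open>\<phi>\<close> is a unipotent group in the product of two matrix algebras, and it is closed under
roots. The logarithms of such a group form a Lie algebra over the rationals
(\<open>log_set_subspace\<close>, \<open>log_set_bracket\<close>), so \<open>D\<close> is additive and preserves brackets, although \<open>\<phi>\<close> is not
assumed to be algebraic or continuous. On the other hand, the logarithms of the rational points of \<open>U\<close>
can be multiplied by any \<open>t\<close> in the first field (\<open>rational_points_log_scale\<close>), because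
\<open>exp (t x)\<close> is polynomial in \<open>t\<close> and lies in \<open>U\<close> for every natural number \<open>t\<close>. Together,
\<open>[D (t x), D y] = D (t [x, y]) = [D x, D (t y)]\<close>.

By this identity the maps \<open>D x \<mapsto> D (t x)\<close> are well defined on the span of the image of \<open>D\<close> modulo its
elements that commute with the image of \<open>D\<close>. This is a space of finite dimension over the second
field, and \<open>t\<close> acts on it by a homomorphism of rings that maps \<open>1\<close> to the identity. If there is no
such homomorphism except into the zero ring, then the space is zero, which means that the image of \<open>D\<close> is
commutative (\<open>balanced_family_commutes\<close>).

Finite series for all points at once need a common bound on the nilpotency of all products of
elements \<open>g - 1\<close>, which is a theorem of Kolchin (\<open>kolchin\<close>). The span of these elements is an algebra of
matrices of trace \<open>0\<close>; in characteristic \<open>0\<close> its elements are nilpotent (\<open>mtrace_powers_nilpotent\<close>), and a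
nil algebra of finite dimension is nilpotent (\<open>nil_algebra_nilpotent\<close>).
\<close>

section \<open>Polynomial functions in algebras over the rationals\<close>

text \<open>The exponential series needs rational scalars only, so the theory of logarithms is developed for
algebras over the rationals. It is applied to a product of two matrix algebras over different
fields, and the rationals are what these fields have in common.\<close>

class rat_algebra = ring_1 +
  fixes qscale :: "rat \<Rightarrow> 'a \<Rightarrow> 'a" (infixr \<open>*q\<close> 75)
  assumes qscale_right_distrib: "a *q (x + y) = a *q x + a *q y"
    and qscale_left_distrib: "(a + b) *q x = a *q x + b *q x"
    and qscale_qscale: "a *q b *q x = (a * b) *q x"
    and qscale_one: "1 *q x = x"
    and mult_qscale_left: "(a *q x) * y = a *q (x * y)"
    and mult_qscale_right: "x * (a *q y) = a *q (x * y)"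

interpretation Q: vector_space "qscale :: rat \<Rightarrow> 'a \<Rightarrow> 'a::rat_algebra"
  by unfold_locales
    (simp_all add: qscale_right_distrib qscale_left_distrib qscale_qscale qscale_one)

lemma power_qscale: "(a *q x) ^ n = (a ^ n) *q (x ^ n)" for x :: "'a::rat_algebra"
  by (induction n) (simp_all add: mult_qscale_left mult_qscale_right mult.commute)

text \<open>Horner form: since the variable is a scalar, it makes sense in a noncommutative algebra, and sums and
products of such functions can be treated by induction.\<close>

inductive_set poly_funs :: "'a::rat_algebra set \<Rightarrow> (rat \<Rightarrow> 'a) set" for S where
  const: "a \<in> S \<Longrightarrow> (\<lambda>_. a) \<in> poly_funs S"
| step: "a \<in> S \<Longrightarrow> f \<in> poly_funs S \<Longrightarrow> (\<lambda>t. a + t *q f t) \<in> poly_funs S"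

lemma poly_funs_coeffs:
  assumes "f \<in> poly_funs S"
  shows "\<exists>d b. (\<forall>t. f t = (\<Sum>i\<le>d. t ^ i *q b i))"
  using assms
proof induction
  case (const a)
  show ?case by (rule exI[of _ 0], rule exI[of _ "\<lambda>_. a"]) simp
next
  case (step a f)
  then obtain d b where fb: "\<And>t. f t = (\<Sum>i\<le>d. t ^ i *q b i)" by blast
  have "a + t *q f t = (\<Sum>i\<le>Suc d. t ^ i *q (case i of 0 \<Rightarrow> a | Suc j \<Rightarrow> b j))" for t
    by (subst sum.atMost_Suc_shift) (simp add: fb Q.scale_sum_right)
  then show ?case by blast
qed

text \<open>The combination \<open>f (2 * t) - 2 ^ (d + 1) * f t\<close> lowers the degree and multiplies each remaining
coefficient by a nonzero rational, which gives the lower coefficients by induction; the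
leading coefficient is then a difference of elements of \<open>W\<close>.\<close>

lemma coeffs_in_subspace:
  assumes W: "Q.subspace W"
    and "\<And>t. t \<noteq> 0 \<Longrightarrow> (\<Sum>i\<le>d. t ^ i *q b i) \<in> W"
  shows "\<forall>i\<le>d. b i \<in> W"
  using assms(2)
proof (induction d arbitrary: b)
  case 0
  from 0[of 1] show ?case by simp
next
  case (Suc d)
  define e where "e i = (2 ^ i - 2 ^ Suc d) *q b i" for i
  have "(\<Sum>i\<le>d. t ^ i *q e i) \<in> W" if "t \<noteq> 0" for t :: rat
  proof -
    let ?f = "\<lambda>t. \<Sum>i\<le>Suc d. t ^ i *q b i"
    have "(\<Sum>i\<le>d. t ^ i *q e i) = (\<Sum>i\<le>Suc d. t ^ i *q e i)"
      by (simp add: e_def)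
    also have "\<dots> = ?f (2 * t) - 2 ^ Suc d *q ?f t"
      unfolding e_def Q.scale_sum_right sum_subtractf[symmetric]
      by (rule sum.cong) (simp_all add: Q.scale_left_diff_distrib power_mult_distrib algebra_simps)
    also have "\<dots> \<in> W"
      using W Suc.prems[OF that] Suc.prems[of "2 * t"] that
      by (intro Q.subspace_diff Q.subspace_scale) auto
    finally show ?thesis .
  qed
  then have e: "\<forall>i\<le>d. e i \<in> W" by (rule Suc.IH)
  have low: "b i \<in> W" if "i \<le> d" for i
  proof -
    have "(2::rat) ^ i < 2 ^ Suc d" using that by (intro power_strict_increasing) auto
    then have "b i = (1 / (2 ^ i - 2 ^ Suc d)) *q e i" by (simp add: e_def)
    then show ?thesis using W e that by (metis Q.subspace_scale)
  qed
  have "b (Suc d) = (\<Sum>i\<le>Suc d. 1 ^ i *q b i) - (\<Sum>i\<le>d. b i)" by simp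
  also have "\<dots> \<in> W"
    by (intro Q.subspace_diff[OF W] Q.subspace_sum[OF W] Suc.prems) (simp_all add: low)
  finally have "b (Suc d) \<in> W" .
  with low show ?case by (metis le_Suc_eq)
qed

text \<open>This replaces a limit \<open>t \<longlonglongrightarrow> 0\<close>: a subspace that contains the values of a polynomial function away
from \<open>0\<close> contains its value at \<open>0\<close>. Homomorphisms that are not continuous can be treated because this
argument is purely algebraic.\<close>

lemma poly_funs_value_0:
  assumes "f \<in> poly_funs S" and W: "Q.subspace W" and v: "\<And>t. t \<noteq> 0 \<Longrightarrow> f t \<in> W"
  shows "f 0 \<in> W"
proof -
  obtain d b where fb: "\<And>t. f t = (\<Sum>i\<le>d. t ^ i *q b i)"
    using poly_funs_coeffs[OF assms(1)] by blast
  have "\<forall>i\<le>d. b i \<in> W" by (rule coeffs_in_subspace[OF W]) (use v in \<open>simp add: fb\<close>)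
  then show ?thesis unfolding fb using W by (intro Q.subspace_sum Q.subspace_scale) auto
qed

lemma poly_funs_in:
  assumes "f \<in> poly_funs S" "Q.subspace S"
  shows "f t \<in> S"
  using assms by induction (auto intro: Q.subspace_add Q.subspace_scale)

lemma poly_funs_mono: "f \<in> poly_funs S \<Longrightarrow> S \<subseteq> T \<Longrightarrow> f \<in> poly_funs T"
  by (induction rule: poly_funs.induct) (auto intro: poly_funs.intros)

lemma poly_funs_var:
  assumes "f \<in> poly_funs S" "Q.subspace S"
  shows "(\<lambda>t. t *q f t) \<in> poly_funs S"
  using poly_funs.step[OF Q.subspace_0[OF assms(2)] assms(1)] by simp

lemma poly_funs_var_power:
  assumes "f \<in> poly_funs S" "Q.subspace S"
  shows "(\<lambda>t. t ^ n *q f t) \<in> poly_funs S"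
proof (induction n)
  case (Suc n)
  from poly_funs_var[OF this assms(2)] show ?case by simp
qed (use assms in simp)

lemma poly_funs_add:
  assumes "f \<in> poly_funs S" "g \<in> poly_funs S" and S: "Q.subspace S"
  shows "(\<lambda>t. f t + g t) \<in> poly_funs S"
  using assms(1,2)
proof (induction arbitrary: g)
  case (const a)
  from const(2) show ?case
  proof cases
    case (const b)
    then show ?thesis using \<open>a \<in> S\<close> S by (auto intro: poly_funs.const Q.subspace_add)
  next
    case (step b h)
    then show ?thesis
      using poly_funs.step[of "a + b" S h] \<open>a \<in> S\<close> S by (simp add: Q.subspace_add add.assoc)
  qed
next
  case (step a f)
  from step(4) show ?case
  proof cases
    case (const b)
    then show ?thesis
      using poly_funs.step[of "a + b" S f] step S by (simp add: Q.subspace_add ac_simps)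
  next
    case (step b h)
    have "(\<lambda>t. (a + b) + t *q (f t + h t)) \<in> poly_funs S"
      by (intro poly_funs.step step.IH Q.subspace_add[OF S]) (fact \<open>a \<in> S\<close> | fact step)+
    then show ?thesis by (simp add: step(1) Q.scale_right_distrib ac_simps)
  qed
qed

lemma poly_funs_scale:
  assumes "f \<in> poly_funs S" and S: "Q.subspace S"
  shows "(\<lambda>t. q *q f t) \<in> poly_funs S"
  using assms(1)
proof induction
  case (const a)
  then show ?case using S by (auto intro: poly_funs.const Q.subspace_scale)
next
  case (step a f)
  from poly_funs.step[OF Q.subspace_scale[OF S step(1), of q] step.IH] show ?case
    by (simp add: Q.scale_right_distrib mult.commute)
qed

lemma poly_funs_diff:
  assumes "f \<in> poly_funs S" "g \<in> poly_funs S" and S: "Q.subspace S"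
  shows "(\<lambda>t. f t - g t) \<in> poly_funs S"
  using poly_funs_add[OF assms(1) poly_funs_scale[OF assms(2) S, of "-1"] S] by simp

lemma poly_funs_sum:
  assumes "\<And>i. i \<in> A \<Longrightarrow> f i \<in> poly_funs S" and S: "Q.subspace S"
  shows "(\<lambda>t. \<Sum>i\<in>A. f i t) \<in> poly_funs S"
  using assms(1)
proof (induction A rule: infinite_finite_induct)
  case (insert a A)
  then show ?case using poly_funs_add[of "f a" S "\<lambda>t. \<Sum>i\<in>A. f i t"] S by simp
qed (use S in \<open>auto intro: poly_funs.const Q.subspace_0\<close>)

lemma poly_funs_mult:
  assumes "f \<in> poly_funs S" "g \<in> poly_funs T"
    and U: "Q.subspace U" and ST: "\<And>x y. x \<in> S \<Longrightarrow> y \<in> T \<Longrightarrow> x * y \<in> U"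
  shows "(\<lambda>t. f t * g t) \<in> poly_funs U"
  using assms(1)
proof induction
  have *: "(\<lambda>t. a * g t) \<in> poly_funs U" if "a \<in> S" for a
    using assms(2)
  proof induction
    case (step b g)
    from poly_funs.step[OF ST[OF that step(1)] step.IH] show ?case
      by (simp add: distrib_left mult_qscale_right)
  qed (use that ST in \<open>auto intro: poly_funs.const\<close>)
  {
    case (const a)
    then show ?case by (rule *)
  next
    case (step a f)
    from poly_funs_add[OF *[OF step(1)] poly_funs_var[OF step.IH U] U] show ?case
      by (simp add: distrib_right mult_qscale_left)
  }
qed

lemma poly_funs_split_0:
  assumes "f \<in> poly_funs S" "Q.subspace S"
  shows "\<exists>g \<in> poly_funs S. \<forall>t. f t = f 0 + t *q g t"
  using assms(1)
proof cases
  case (const a)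
  then show ?thesis using assms(2)
    by (intro bexI[of _ "\<lambda>_. 0"]) (auto intro: poly_funs.const Q.subspace_0)
qed auto

section \<open>Exponentials of nilpotent elements\<close>

text \<open>The exponential series, cut off after degree \<open>c\<close>. It is used only on elements whose powers beyond
\<open>c\<close> vanish.\<close>

definition nexp :: "nat \<Rightarrow> 'a::rat_algebra \<Rightarrow> 'a" where
  "nexp c x = (\<Sum>i\<le>c. (1 / fact i) *q x ^ i)"

text \<open>The second order remainder, scaled so that \<open>nexp c (t *q x) = 1 + t *q x + t\<^sup>2 *q exp_tail c x t\<close>.\<close>

definition exp_tail :: "nat \<Rightarrow> 'a::rat_algebra \<Rightarrow> rat \<Rightarrow> 'a" where
  "exp_tail c x t = (\<Sum>i<c. t ^ i *q (1 / fact (i + 2)) *q x ^ (i + 2))"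

text \<open>The binomial theorem for commuting elements of a noncommutative algebra, with the factorials
distributed as they occur in the product of two exponential series.\<close>

lemma divided_power_add_commuting:
  fixes x y :: "'a::rat_algebra"
  assumes "x * y = y * x"
  shows "(1 / fact n) *q (x + y) ^ n =
    (\<Sum>i\<le>n. ((1 / fact i) *q x ^ i) * ((1 / fact (n - i)) *q y ^ (n - i)))"
proof -
  define S :: "'a \<Rightarrow> nat \<Rightarrow> 'a" where "S x n = (1 / fact n) *q x ^ n" for x n
  have step: "x * S x n = of_nat (Suc n) *q S x (Suc n)" for x n
  proof -
    have "of_nat (Suc n) * (1 / fact (Suc n)) = (1 / fact n :: rat)"
      by (simp del: of_nat_Suc)
    then show ?thesis
      by (simp only: S_def mult_qscale_right Q.scale_scale power_Suc)
  qed
  have comm: "x ^ i * y = y * x ^ i" for i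
    by (rule power_commuting_commutes[OF assms])
  have "S (x + y) n = (\<Sum>i\<le>n. S x i * S y (n - i))"
  proof (induction n)
    case (Suc n)
    have "of_nat (Suc n) *q S (x + y) (Suc n) = (x + y) * (\<Sum>i\<le>n. S x i * S y (n - i))"
      by (simp only: step[symmetric] Suc.IH)
    also have "\<dots> = (\<Sum>i\<le>n. x * S x i * S y (n - i)) + (\<Sum>i\<le>n. S x i * (y * S y (n - i)))"
      unfolding sum_distrib_left sum.distrib[symmetric]
    proof (rule sum.cong)
      fix i
      have "y * S x i = S x i * y"
        by (simp add: S_def mult_qscale_left mult_qscale_right comm)
      then have "y * (S x i * S y (n - i)) = S x i * (y * S y (n - i))"
        by (simp only: mult.assoc[symmetric])
      then show "(x + y) * (S x i * S y (n - i)) =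
          x * S x i * S y (n - i) + S x i * (y * S y (n - i))"
        by (simp only: distrib_right mult.assoc)
    qed simp
    also have "(\<Sum>i\<le>n. x * S x i * S y (n - i)) =
        (\<Sum>i\<le>Suc n. of_nat i *q (S x i * S y (Suc n - i)))"
      by (subst sum.atMost_Suc_shift) (simp add: step mult_qscale_left del: of_nat_Suc)
    also have "(\<Sum>i\<le>n. S x i * (y * S y (n - i))) =
        (\<Sum>i\<le>Suc n. of_nat (Suc n - i) *q (S x i * S y (Suc n - i)))"
      by (simp add: step mult_qscale_right Suc_diff_le del: of_nat_Suc)
        (intro sum.cong refl arg_cong2[where f = qscale], simp add: of_nat_diff)
    also have "(\<Sum>i\<le>Suc n. of_nat i *q (S x i * S y (Suc n - i))) +
        (\<Sum>i\<le>Suc n. of_nat (Suc n - i) *q (S x i * S y (Suc n - i))) =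
        of_nat (Suc n) *q (\<Sum>i\<le>Suc n. S x i * S y (Suc n - i))"
      unfolding sum.distrib[symmetric] Q.scale_sum_right Q.scale_left_distrib[symmetric]
      by (intro sum.cong refl arg_cong2[where f = qscale])
        (simp add: of_nat_add[symmetric] del: of_nat_Suc of_nat_add)
    finally have *: "of_nat (Suc n) *q S (x + y) (Suc n) =
        of_nat (Suc n) *q (\<Sum>i\<le>Suc n. S x i * S y (Suc n - i))" .
    have "(of_nat (Suc n) :: rat) \<noteq> 0" by (simp del: of_nat_Suc)
    with * show ?case by (simp only: Q.scale_cancel_left) blast
  qed (simp add: S_def)
  then show ?thesis by (simp add: S_def)
qed

text \<open>The typical example is \<open>F k = N ^ (k + 1)\<close> for a nilpotent algebra \<open>N = F 0\<close> without unit. With this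
numbering a product of elements of levels \<open>i\<close> and \<open>j\<close> has level \<open>i + j + 1\<close>, so that every product
raises the level; all inductions on nilpotency below rest on that.\<close>

locale nilpotent_filtration =
  fixes F :: "nat \<Rightarrow> 'a::rat_algebra set" and c :: nat
  assumes subspace: "Q.subspace (F k)"
    and decreasing: "F (Suc k) \<subseteq> F k"
    and mult: "x \<in> F i \<Longrightarrow> y \<in> F j \<Longrightarrow> x * y \<in> F (Suc (i + j))"
    and vanishing: "F c \<subseteq> {0}"
begin

lemma antimono: "i \<le> j \<Longrightarrow> F j \<subseteq> F i"
  by (rule lift_Suc_antimono_le[of F, OF decreasing])

lemma mult_next: "x \<in> F k \<Longrightarrow> y \<in> F 0 \<Longrightarrow> x * y \<in> F (Suc k)"
  using mult[of x k y 0] by simp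

lemma mult_same: "x \<in> F k \<Longrightarrow> y \<in> F k \<Longrightarrow> x * y \<in> F (Suc k)"
  using mult_next antimono[of 0 k] by auto

lemma eq_0: "x \<in> F k \<Longrightarrow> c \<le> k \<Longrightarrow> x = 0"
  using antimono[of c k] vanishing by auto

lemma power_in: "x \<in> F 0 \<Longrightarrow> x ^ Suc i \<in> F i"
proof (induction i)
  case (Suc i)
  from mult[OF Suc.prems Suc.IH[OF Suc.prems]] show ?case by simp
qed simp

lemma power_eq_0: "x \<in> F 0 \<Longrightarrow> c < i \<Longrightarrow> x ^ i = 0"
  using power_in[of x "i - 1"] eq_0[of _ "i - 1"] by (cases i) auto

lemma power_mult_power_eq_0:
  assumes "x \<in> F 0" "y \<in> F 0" "c < i + j"
  shows "x ^ i * y ^ j = 0"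
proof (cases "i = 0 \<or> j = 0")
  case True
  then show ?thesis using assms power_eq_0[of x i] power_eq_0[of y j] by auto
next
  case False
  then obtain i' j' where ij: "i = Suc i'" "j = Suc j'" by (metis not0_implies_Suc)
  show ?thesis
    using mult[OF power_in[OF assms(1), of i'] power_in[OF assms(2), of j']] assms(3)
    unfolding ij by (intro eq_0) auto
qed

lemma nexp_add:
  assumes x: "x \<in> F 0" and y: "y \<in> F 0" and "x * y = y * x"
  shows "nexp c (x + y) = nexp c x * nexp c y"
proof -
  define g where "g i j = ((1 / fact i) *q x ^ i) * ((1 / fact j) *q y ^ j)" for i j
  have g0: "g i j = 0" if "c < i + j" for i j
    using power_mult_power_eq_0[OF x y that] by (simp add: g_def mult_qscale_left mult_qscale_right)
  have "nexp c x * nexp c y = (\<Sum>(i, j)\<in>{..c} \<times> {..c}. g i j)"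
    by (simp add: nexp_def sum_product sum.cartesian_product g_def)
  also have "\<dots> = (\<Sum>(i, j)\<in>{(i, j). i + j \<le> c}. g i j)"
    by (rule sum.mono_neutral_right) (auto intro: g0)
  also have "\<dots> = (\<Sum>n\<le>c. \<Sum>i\<le>n. g i (n - i))"
    by (rule sum.triangle_reindex_eq)
  also have "\<dots> = nexp c (x + y)"
    by (simp only: nexp_def g_def divided_power_add_commuting[OF assms(3)])
  finally show ?thesis ..
qed

lemma nexp_commute:
  assumes "x \<in> F 0" "y \<in> F 0" "x * y = y * x"
  shows "nexp c x * nexp c y = nexp c y * nexp c x"
  using nexp_add[OF assms] nexp_add[OF assms(2,1) assms(3)[symmetric]] by (simp add: add.commute)

lemma nexp_0: "nexp c 0 = 1"
  by (simp add: nexp_def power_0_left if_distrib cong: if_cong)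

lemma uminus_in: "x \<in> F k \<Longrightarrow> - x \<in> F k"
  by (rule Q.subspace_neg[OF subspace])

lemma nexp_minus:
  assumes "x \<in> F 0"
  shows "nexp c x * nexp c (- x) = 1" "nexp c (- x) * nexp c x = 1"
  using nexp_add[OF assms uminus_in[OF assms]] nexp_add[OF uminus_in[OF assms] assms]
  by (simp_all add: nexp_0)

lemma nexp_expand:
  assumes "x \<in> F 0"
  shows "nexp c (t *q x) = 1 + t *q x + t\<^sup>2 *q exp_tail c x t"
proof -
  have "nexp c (t *q x) = (\<Sum>i\<le>Suc c. (1 / fact i) *q (t *q x) ^ i)"
    by (simp add: nexp_def power_qscale power_eq_0[OF assms, of "Suc c"] del: power_Suc)
  also have "\<dots> = 1 + (\<Sum>i\<le>c. (1 / fact (Suc i)) *q (t *q x) ^ Suc i)"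
    by (subst sum.atMost_Suc_shift) simp
  also have "(\<Sum>i\<le>c. (1 / fact (Suc i)) *q (t *q x) ^ Suc i) =
      (\<Sum>i<Suc c. (1 / fact (Suc i)) *q (t *q x) ^ Suc i)"
    by (simp only: lessThan_Suc_atMost)
  also have "\<dots> = t *q x + (\<Sum>i<c. (1 / fact (Suc (Suc i))) *q (t *q x) ^ Suc (Suc i))"
    by (subst sum.lessThan_Suc_shift) simp
  also have "(\<Sum>i<c. (1 / fact (Suc (Suc i))) *q (t *q x) ^ Suc (Suc i)) = t\<^sup>2 *q exp_tail c x t"
    unfolding exp_tail_def Q.scale_sum_right
  proof (rule sum.cong)
    fix i
    have "t ^ Suc (Suc i) = t\<^sup>2 * t ^ i" by (simp add: power2_eq_square)
    then show "(1 / fact (Suc (Suc i))) *q (t *q x) ^ Suc (Suc i) =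
        t\<^sup>2 *q t ^ i *q (1 / fact (i + 2)) *q x ^ (i + 2)"
      by (simp only: power_qscale Q.scale_scale add_2_eq_Suc' mult_ac)
  qed simp
  finally show ?thesis by (simp add: add.assoc)
qed

lemma nexp_expand_1:
  assumes "x \<in> F 0"
  shows "nexp c x = 1 + x + exp_tail c x 1"
  using nexp_expand[OF assms, of 1] by simp

lemma poly_funs_power:
  assumes "w \<in> poly_funs (F k)"
  shows "(\<lambda>t. w t ^ Suc i) \<in> poly_funs (F k)"
proof (induction i)
  case (Suc i)
  from poly_funs_mult[OF assms Suc subspace[of "Suc k"] mult_same] decreasing[of k]
  show ?case by (auto intro: poly_funs_mono)
qed (use assms in simp)

lemma poly_funs_mult_same:
  assumes "f \<in> poly_funs (F k)" "g \<in> poly_funs (F k)"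
  shows "(\<lambda>t. f t * g t) \<in> poly_funs (F (Suc k))"
  by (rule poly_funs_mult[OF assms subspace mult_same])

lemma poly_funs_next: "f \<in> poly_funs (F (Suc k)) \<Longrightarrow> f \<in> poly_funs (F k)"
  by (rule poly_funs_mono[OF _ decreasing])

text \<open>The remainder consists of products of at least two factors, which gains one level of the
filtration.\<close>

lemma exp_tail_poly:
  assumes "w \<in> poly_funs (F k)"
  shows "(\<lambda>t. exp_tail c (w t) t) \<in> poly_funs (F (Suc k))"
    and "(\<lambda>t. exp_tail c (w t) 1) \<in> poly_funs (F (Suc k))"
proof -
  have *: "(\<lambda>t. w t ^ (i + 2)) \<in> poly_funs (F (Suc k))" for i
    using poly_funs_mult_same[OF assms poly_funs_power[OF assms, of i]] by simp
  show "(\<lambda>t. exp_tail c (w t) t) \<in> poly_funs (F (Suc k))"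
    and "(\<lambda>t. exp_tail c (w t) 1) \<in> poly_funs (F (Suc k))"
    unfolding exp_tail_def
    by (intro poly_funs_sum poly_funs_var_power poly_funs_scale * subspace)+
qed

lemma exp_tail_in:
  assumes "x \<in> F k"
  shows "exp_tail c x t \<in> F (Suc k)"
  using poly_funs_in[OF exp_tail_poly(1)[OF poly_funs.const[OF assms]] subspace] .

lemma nexp_in:
  assumes "x \<in> F 0"
  shows "nexp c x - 1 \<in> F 0"
  using exp_tail_in[OF assms, of 1] decreasing[of 0] assms Q.subspace_add[OF subspace]
  by (subst nexp_expand_1[OF assms]) auto

text \<open>Since \<open>nexp c x = 1\<close> expresses \<open>x\<close> by its remainder, \<open>x\<close> descends through all levels.\<close>

lemma nexp_eq_1:
  assumes "x \<in> F 0" "nexp c x = 1"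
  shows "x = 0"
proof -
  have "x \<in> F k" for k
  proof (induction k)
    case (Suc k)
    have "x = - exp_tail c x 1"
      using nexp_expand_1[OF assms(1)] assms(2) by (simp add: eq_neg_iff_add_eq_0)
    then show ?case using uminus_in[OF exp_tail_in[OF Suc, of 1]] by simp
  qed (fact assms)
  then show ?thesis using eq_0 by blast
qed

text \<open>Logarithms by successive approximation: \<open>nexp c (- y) * (1 + y)\<close> is \<open>1\<close> plus a term one level higher,
whose logarithm \<open>x\<close> exists by induction and commutes with \<open>y\<close>, so that \<open>y + x\<close> is a logarithm of
\<open>1 + y\<close>. Doing this for polynomial functions shows that the logarithm depends polynomially on a
parameter.\<close>

lemma poly_log_exists:
  assumes "y \<in> poly_funs (F k)"
  shows "\<exists>x \<in> poly_funs (F k). \<forall>t. nexp c (x t) = 1 + y t \<and>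
    (\<forall>z. z * y t = y t * z \<longrightarrow> z * x t = x t * z)"
  using assms
proof (induction "c - k" arbitrary: k y)
  case 0
  then have "y t = 0" for t
    using poly_funs_in[OF 0(2) subspace] by (intro eq_0) auto
  moreover have "(\<lambda>_. 0) \<in> poly_funs (F k)"
    by (intro poly_funs.const Q.subspace_0 subspace)
  ultimately show ?case by (intro bexI[of _ "\<lambda>_. 0"]) (auto simp: nexp_0)
next
  case (Suc n)
  have y0: "y t \<in> F 0" for t
    using poly_funs_in[OF Suc.prems subspace] antimono[of 0 k] by auto
  define r where "r t = exp_tail c (- y t) 1" for t
  define y' where "y' t = r t + r t * y t - y t * y t" for t
  have my: "(\<lambda>t. - y t) \<in> poly_funs (F k)"
    using poly_funs_scale[OF Suc.prems subspace, of "-1"] by simp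
  have r: "r \<in> poly_funs (F (Suc k))"
    unfolding r_def by (rule exp_tail_poly(2)[OF my])
  have "y' \<in> poly_funs (F (Suc k))"
    unfolding y'_def
    by (intro poly_funs_diff poly_funs_add poly_funs_mult_same r subspace
        poly_funs_next[OF r] Suc.prems)
  moreover have "n = c - Suc k" using Suc.hyps by simp
  ultimately obtain x' where x': "x' \<in> poly_funs (F (Suc k))"
    and ex': "\<And>t. nexp c (x' t) = 1 + y' t"
    and cx': "\<And>t z. z * y' t = y' t * z \<Longrightarrow> z * x' t = x' t * z"
    using Suc.hyps(1)[of "Suc k" y'] by blast
  have x'0: "x' t \<in> F 0" for t
    using poly_funs_in[OF x' subspace] antimono[of 0 "Suc k"] by auto
  have comm: "z * x' t = x' t * z" if z: "z * y t = y t * z" for z t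
  proof -
    have zp: "z * (- y t) ^ i = (- y t) ^ i * z" for i
      by (rule power_commuting_commutes[symmetric]) (simp add: z)
    have zr: "z * r t = r t * z"
      unfolding r_def exp_tail_def sum_distrib_left sum_distrib_right
      by (intro sum.cong refl) (simp only: mult_qscale_left mult_qscale_right zp)
    have "z * y' t = y' t * z"
    proof -
      have "z * (r t * y t) = r t * y t * z" "z * (y t * y t) = y t * y t * z"
        using z zr by (metis mult.assoc)+
      then show ?thesis
        unfolding y'_def distrib_left distrib_right left_diff_distrib right_diff_distrib
        by (simp only: zr)
    qed
    then show ?thesis by (rule cx')
  qed
  have "nexp c (y t + x' t) = 1 + y t" for t
  proof -
    have "nexp c (- y t) * (1 + y t) = 1 + y' t"
      unfolding nexp_expand_1[OF uminus_in[OF y0]] y'_def r_def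
      by (simp add: algebra_simps)
    then have "nexp c (y t) * (nexp c (- y t) * (1 + y t)) = nexp c (y t) * nexp c (x' t)"
      by (simp add: ex')
    then show ?thesis
      using nexp_add[OF y0 x'0 comm] nexp_minus(1)[OF y0, of t]
      by (simp add: mult.assoc[symmetric])
  qed
  moreover have "(\<lambda>t. y t + x' t) \<in> poly_funs (F k)"
    by (intro poly_funs_add Suc.prems poly_funs_next[OF x'] subspace)
  ultimately show ?case
    by (intro bexI[of _ "\<lambda>t. y t + x' t"]) (auto simp: distrib_left distrib_right comm)
qed

lemma log_exists:
  assumes "y \<in> F k"
  shows "\<exists>x \<in> F k. nexp c x = 1 + y \<and> (\<forall>z. z * y = y * z \<longrightarrow> z * x = x * z)"
proof -
  from poly_log_exists[OF poly_funs.const[OF assms]] obtain x where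
    "x \<in> poly_funs (F k)" "nexp c (x 0) = 1 + y \<and> (\<forall>z. z * y = y * z \<longrightarrow> z * x 0 = x 0 * z)"
    by blast
  with poly_funs_in[OF _ subspace] show ?thesis by blast
qed

lemma nexp_commutes: "x * nexp c x = nexp c x * x"
  by (simp add: nexp_def sum_distrib_left sum_distrib_right mult_qscale_left mult_qscale_right
      power_commutes)

text \<open>The logarithm found above commutes with everything that commutes with its exponential, hence with
\<open>x\<close> and with \<open>y\<close>; exponentials of commuting elements with equal value have equal exponents.\<close>

lemma nexp_inj:
  assumes "x \<in> F 0" "y \<in> F 0" "nexp c x = nexp c y"
  shows "x = y"
proof -
  from log_exists[OF nexp_in[OF assms(1)]] obtain l where l: "l \<in> F 0" "nexp c l = nexp c x"
    and comm: "\<And>z. z * nexp c x = nexp c x * z \<Longrightarrow> z * l = l * z"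
    by (auto simp: algebra_simps)
  have "z = l" if z: "z \<in> F 0" "nexp c z = nexp c x" for z
  proof -
    have "z * l = l * z" using nexp_commutes[of z] z comm by simp
    then have "nexp c (z - l) = nexp c z * nexp c (- l)"
      using nexp_add[OF z(1) uminus_in[OF l(1)]] by simp
    also have "\<dots> = 1" using nexp_minus(1)[OF l(1)] l(2) z(2) by simp
    finally have "z - l = 0"
      by (rule nexp_eq_1[OF Q.subspace_diff[OF subspace z(1) l(1)]])
    then show ?thesis by simp
  qed
  from this[of x] this[of y] assms show ?thesis by simp
qed

lemma nexp_of_nat_scale:
  assumes "x \<in> F 0"
  shows "nexp c (of_nat n *q x) = nexp c x ^ n"
proof (induction n)
  case 0
  show ?case by (simp add: nexp_0)
next
  case (Suc n)
  have "nexp c (x + of_nat n *q x) = nexp c x * nexp c (of_nat n *q x)"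
    by (intro nexp_add assms Q.subspace_scale[OF subspace])
      (simp add: mult_qscale_left mult_qscale_right)
  then show ?case using Suc by (simp add: Q.scale_left_distrib)
qed

end

section \<open>Logarithms of a divisible unipotent group\<close>

text \<open>By Malcev, the logarithms of a unipotent group that is closed under roots form a Lie algebra over
the rationals. This section proves it without the Baker-Campbell-Hausdorff formula.\<close>

locale divisible_unipotent_group = nilpotent_filtration F c
  for F :: "nat \<Rightarrow> 'a::rat_algebra set" and c :: nat +
  fixes G :: "'a set"
  assumes one_in: "1 \<in> G"
    and mult_in: "g \<in> G \<Longrightarrow> h \<in> G \<Longrightarrow> g * h \<in> G"
    and inverse_in: "g \<in> G \<Longrightarrow> \<exists>h \<in> G. g * h = 1"
    and root_in: "x \<in> F 0 \<Longrightarrow> nexp c x \<in> G \<Longrightarrow> 0 < n \<Longrightarrow> nexp c ((1 / of_nat n) *q x) \<in> G"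
begin

definition log_set :: "'a set" where
  "log_set = {x \<in> F 0. nexp c x \<in> G}"

lemma log_set_uminus:
  assumes "x \<in> log_set"
  shows "- x \<in> log_set"
proof -
  have x: "x \<in> F 0" "nexp c x \<in> G" using assms by (auto simp: log_set_def)
  obtain h where h: "h \<in> G" "nexp c x * h = 1" using inverse_in[OF x(2)] by blast
  have "h = nexp c (- x) * (nexp c x * h)"
    using nexp_minus(2)[OF x(1)] by (simp add: mult.assoc[symmetric])
  then show ?thesis using h x by (simp add: log_set_def uminus_in)
qed

lemma log_set_scale:
  assumes "x \<in> log_set"
  shows "q *q x \<in> log_set"
proof -
  have nat: "of_nat n *q y \<in> log_set" if y: "y \<in> log_set" for n y
  proof -
    have "nexp c y ^ n \<in> G"
      by (induction n) (use y in \<open>auto simp: log_set_def one_in mult_in\<close>)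
    then show ?thesis using y
      by (simp add: log_set_def nexp_of_nat_scale Q.subspace_scale[OF subspace])
  qed
  obtain a b where q: "q = of_int a / of_int b" "b > 0"
    by (metis quotient_of_div quotient_of_denom_pos surj_pair)
  define n where "n = nat b"
  have n: "0 < n" "q = of_int a / of_nat n" using q by (simp_all add: n_def)
  have y: "(1 / of_nat n) *q x \<in> log_set"
    using assms root_in n(1) by (auto simp: log_set_def Q.subspace_scale[OF subspace])
  show ?thesis
  proof (cases "a \<ge> 0")
    case True
    then have "q *q x = of_nat (nat a) *q (1 / of_nat n) *q x" by (simp add: n)
    then show ?thesis by (simp only: nat[OF y])
  next
    case False
    then have "q *q x = of_nat (nat (- a)) *q - ((1 / of_nat n) *q x)" by (simp add: n)
    then show ?thesis by (simp only: nat[OF log_set_uminus[OF y]])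
  qed
qed

text \<open>The first two terms of the Baker-Campbell-Hausdorff formula along the ray through \<open>(x, y)\<close>: the
logarithm of \<open>exp (t x) exp (t y)\<close> is a polynomial in \<open>t\<close> without constant term, its linear
coefficient is \<open>x + y\<close>, and the remaining terms are products and hence lie one level higher.\<close>

lemma log_of_product:
  assumes x: "x \<in> F k" and y: "y \<in> F k"
  shows "\<exists>s \<in> poly_funs (F (Suc k)). \<forall>t. nexp c (t *q (x + y + t *q s t)) = nexp c (t *q x) * nexp c (t *q y)"
proof -
  have F0: "z \<in> F 0" if "z \<in> F k" for z using that antimono[of 0 k] by auto
  define A where "A z t = exp_tail c z t" for z :: 'a and t
  have A: "A z \<in> poly_funs (F (Suc k))" if "z \<in> F k" for z
    unfolding A_def using exp_tail_poly(1)[OF poly_funs.const[OF that]] .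
  note An = poly_funs_next[OF A]
  define B where "B t = A x t + A y t + x * y + t *q (A x t * y) + t *q (x * A y t)
    + t\<^sup>2 *q (A x t * A y t)" for t
  have B: "B \<in> poly_funs (F (Suc k))"
    unfolding B_def
    by (intro poly_funs_add poly_funs_var poly_funs_var_power poly_funs_mult_same A An x y subspace
        poly_funs.const mult_same)
  define Y where "Y t = t *q (x + y + t *q B t)" for t
  have prod: "nexp c (t *q x) * nexp c (t *q y) = 1 + Y t" for t
    unfolding nexp_expand[OF F0[OF x]] nexp_expand[OF F0[OF y]] Y_def B_def A_def
    by (simp add: distrib_left distrib_right mult_qscale_left mult_qscale_right
        qscale_right_distrib power2_eq_square algebra_simps)
  have "Y \<in> poly_funs (F k)"
    unfolding Y_def
    by (intro poly_funs_var poly_funs_add poly_funs.const poly_funs_next[OF B] x y subspace)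
  then obtain u where u: "u \<in> poly_funs (F k)" and exp_u: "\<And>t. nexp c (u t) = 1 + Y t"
    using poly_log_exists by blast
  \<comment> \<open>Hence \<open>u\<close> is divisible by the variable; comparing the terms of order one identifies the quotient.\<close>
  have u0: "u 0 = 0"
    using nexp_eq_1[OF F0[OF poly_funs_in[OF u subspace]], of 0] exp_u[of 0] by (simp add: Y_def)
  obtain w where w: "w \<in> poly_funs (F k)" and uw: "\<And>t. u t = t *q w t"
    using poly_funs_split_0[OF u subspace] u0 by auto
  define s where "s t = B t - exp_tail c (w t) t" for t
  have s: "s \<in> poly_funs (F (Suc k))"
    unfolding s_def by (intro poly_funs_diff B exp_tail_poly(1) w subspace)
  have "t *q (x + y + t *q s t) = u t" for t
  proof -
    have "w t \<in> F 0" using F0 poly_funs_in[OF w subspace] by blast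
    from nexp_expand[OF this, of t] exp_u[of t]
    have "u t = Y t - t\<^sup>2 *q exp_tail c (w t) t" by (simp add: uw eq_diff_eq add.assoc)
    then show ?thesis
      by (simp add: s_def Y_def power2_eq_square Q.scale_right_distrib Q.scale_right_diff_distrib)
  qed
  then have "nexp c (t *q (x + y + t *q s t)) = nexp c (t *q x) * nexp c (t *q y)" for t
    by (simp only: exp_u prod)
  with s show ?thesis by blast
qed

text \<open>Downward induction on the level. With \<open>w t = x + y + t s(t)\<close> from the previous lemma, \<open>w t\<close> is a
logarithm of a group element for each \<open>t \<noteq> 0\<close>, and \<open>x + y = w 0\<close> is the wanted limit. The quotients
\<open>exp (- w 1) exp (w t)\<close> have logarithms \<open>v t\<close> one level higher, where the logarithms of group
elements form a subspace by induction; hence \<open>v 0\<close> belongs to it, and \<open>exp (w 0)\<close> is a product of two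
group elements.\<close>

lemma log_set_add_filtered:
  assumes "x \<in> log_set \<inter> F k" "y \<in> log_set \<inter> F k"
  shows "x + y \<in> log_set"
  using assms
proof (induction "c - k" arbitrary: k x y)
  case 0
  then have "x = 0" using eq_0[of x k] by auto
  then show ?case using 0 by auto
next
  case (Suc n)
  define W where "W = log_set \<inter> F (Suc k)"
  have W: "Q.subspace W"
    unfolding Q.subspace_def
  proof (intro conjI ballI allI)
    show "0 \<in> W"
      by (auto simp: W_def log_set_def nexp_0 one_in Q.subspace_0[OF subspace])
    show "a + b \<in> W" if "a \<in> W" "b \<in> W" for a b
      using Suc.hyps(1)[of "Suc k" a b] Suc.hyps(2) that Q.subspace_add[OF subspace[of "Suc k"]]
      by (auto simp: W_def)
    show "q *q a \<in> W" if "a \<in> W" for q a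
      using that log_set_scale Q.subspace_scale[OF subspace] by (auto simp: W_def)
  qed
  have x: "x \<in> log_set" "x \<in> F k" and y: "y \<in> log_set" "y \<in> F k" using Suc.prems by auto
  obtain s where s: "s \<in> poly_funs (F (Suc k))"
    and exp_s: "\<And>t. nexp c (t *q (x + y + t *q s t)) = nexp c (t *q x) * nexp c (t *q y)"
    using log_of_product[OF x(2) y(2)] by blast
  define w where "w t = x + y + t *q s t" for t
  have w_poly: "w \<in> poly_funs (F k)"
    unfolding w_def
    by (intro poly_funs_add poly_funs_var poly_funs.const x y subspace poly_funs_next[OF s])
  have wk: "w t \<in> F k" for t by (rule poly_funs_in[OF w_poly subspace])
  then have w0: "w t \<in> F 0" for t using antimono[of 0 k] by auto
  have w_log: "w t \<in> log_set" if "t \<noteq> 0" for t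
  proof -
    have "nexp c (t *q w t) \<in> G"
      using log_set_scale[OF x(1), of t] log_set_scale[OF y(1), of t] mult_in
      by (simp add: exp_s w_def log_set_def)
    then have "t *q w t \<in> log_set" using w0 by (simp add: log_set_def Q.subspace_scale[OF subspace])
    from log_set_scale[OF this, of "1 / t"] that show ?thesis by simp
  qed
  define z where "z t = exp_tail c (w t) 1 + exp_tail c (- w 1) 1 + t *q s t - s 1
    + (nexp c (- w 1) - 1) * (nexp c (w t) - 1)" for t
  have nw1: "- w 1 \<in> F k" by (rule uminus_in[OF wk])
  have ex1: "nexp c (- w 1) - 1 \<in> F k"
    using exp_tail_in[OF nw1, of 1] decreasing nw1 nexp_expand_1[OF uminus_in[OF w0], of 1]
      Q.subspace_add[OF subspace, of "- w 1" k]
    by (auto simp: add.assoc)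
  have ext: "(\<lambda>t. nexp c (w t) - 1) \<in> poly_funs (F k)"
  proof -
    have "(\<lambda>t. w t + exp_tail c (w t) 1) \<in> poly_funs (F k)"
      by (intro poly_funs_add w_poly poly_funs_next[OF exp_tail_poly(2)[OF w_poly]] subspace)
    then show ?thesis by (simp add: nexp_expand_1[OF w0] add.assoc)
  qed
  have "z \<in> poly_funs (F (Suc k))"
    unfolding z_def
    by (intro poly_funs_add poly_funs_diff poly_funs_var exp_tail_poly(2) w_poly s subspace
        poly_funs.const exp_tail_in nw1 poly_funs_in[OF s subspace] poly_funs_mult_same ex1 ext)
  then obtain v where v: "v \<in> poly_funs (F (Suc k))" and exp_v: "\<And>t. nexp c (v t) = 1 + z t"
    using poly_log_exists by blast
  have quot: "1 + z t = nexp c (- w 1) * nexp c (w t)" for t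
  proof -
    have "nexp c (w t) = 1 + w t + exp_tail c (w t) 1"
      "nexp c (- w 1) = 1 - w 1 + exp_tail c (- w 1) 1"
      using nexp_expand_1[OF w0, of t] nexp_expand_1[OF uminus_in[OF w0], of 1] by simp_all
    then have "(nexp c (- w 1) - 1) + (nexp c (w t) - 1) =
        (w t - w 1) + (exp_tail c (w t) 1 + exp_tail c (- w 1) 1)"
      by simp
    also have "w t - w 1 = t *q s t - s 1" by (simp add: w_def)
    finally have "exp_tail c (w t) 1 + exp_tail c (- w 1) 1 + t *q s t - s 1 =
        (nexp c (- w 1) - 1) + (nexp c (w t) - 1)"
      by simp
    then have "z t = (nexp c (- w 1) - 1) + (nexp c (w t) - 1)
        + (nexp c (- w 1) - 1) * (nexp c (w t) - 1)"
      unfolding z_def by (simp only:)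
    then show ?thesis by (simp add: left_diff_distrib right_diff_distrib)
  qed
  have "v t \<in> W" if "t \<noteq> 0" for t
  proof -
    have "nexp c (- w 1) \<in> G" "nexp c (w t) \<in> G"
      using w_log[OF that] log_set_uminus[OF w_log[of 1]] by (auto simp: log_set_def)
    moreover have "v t \<in> F (Suc k)" by (rule poly_funs_in[OF v subspace])
    ultimately show ?thesis
      using mult_in antimono[of 0 "Suc k"] by (auto simp: W_def log_set_def exp_v quot)
  qed
  then have "v 0 \<in> W" by (rule poly_funs_value_0[OF v W])
  then have "nexp c (- w 1) * nexp c (w 0) \<in> G"
    by (simp add: W_def log_set_def exp_v quot)
  moreover have "nexp c (w 1) \<in> G" using w_log[of 1] by (simp add: log_set_def)
  ultimately have "nexp c (w 1) * (nexp c (- w 1) * nexp c (w 0)) \<in> G" by (rule mult_in[rotated])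
  then have "nexp c (w 0) \<in> G" using nexp_minus(1)[OF w0, of 1]
    by (simp add: mult.assoc[symmetric])
  then show ?case using w0[of 0] by (simp add: log_set_def w_def)
qed

lemma log_set_subspace: "Q.subspace log_set"
  unfolding Q.subspace_def
proof (intro conjI ballI allI)
  show "0 \<in> log_set" by (simp add: log_set_def nexp_0 one_in Q.subspace_0[OF subspace])
  show "x + y \<in> log_set" if "x \<in> log_set" "y \<in> log_set" for x y
    using log_set_add_filtered[of x 0 y] that by (simp add: log_set_def)
qed (rule log_set_scale)

lemma nexp_conjugate:
  assumes "x \<in> F 0" "y \<in> F 0"
  shows "nexp c (nexp c y * x * nexp c (- y)) = nexp c y * nexp c x * nexp c (- y)"
proof -
  have "(nexp c y * x * nexp c (- y)) ^ i = nexp c y * x ^ i * nexp c (- y)" for i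
  proof (induction i)
    case (Suc i)
    have "(nexp c y * x * nexp c (- y)) ^ Suc i =
        nexp c y * x * nexp c (- y) * (nexp c y * x ^ i * nexp c (- y))"
      by (simp only: power_Suc Suc.IH)
    also have "\<dots> = nexp c y * x * (nexp c (- y) * nexp c y) * x ^ i * nexp c (- y)"
      by (simp only: mult.assoc)
    finally have "(nexp c y * x * nexp c (- y)) ^ Suc i =
        nexp c y * x * (nexp c (- y) * nexp c y) * x ^ i * nexp c (- y)" .
    then show ?case by (simp only: nexp_minus[OF assms(2)] mult_1_right power_Suc mult.assoc)
  qed (simp add: nexp_minus[OF assms(2)])
  then show ?thesis
    by (simp add: nexp_def[of c x] nexp_def[of c "nexp c y * x * nexp c (- y)"]
        sum_distrib_left sum_distrib_right mult_qscale_left mult_qscale_right)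
qed

text \<open>Conjugation by \<open>exp (t y)\<close> maps \<open>x\<close> to \<open>x + t [y, x] + ...\<close>, a polynomial in \<open>t\<close> with values in the
space of logarithms, so its linear coefficient is a logarithm too.\<close>

lemma log_set_bracket:
  assumes "x \<in> log_set" "y \<in> log_set"
  shows "y * x - x * y \<in> log_set"
proof -
  have x: "x \<in> F 0" "nexp c x \<in> G" and y: "y \<in> F 0" using assms by (auto simp: log_set_def)
  have my: "- y \<in> F 0" by (rule uminus_in[OF y])
  define P where "P t = exp_tail c y t" for t
  define M where "M t = exp_tail c (- y) t" for t
  have P: "P \<in> poly_funs (F 0)" and M: "M \<in> poly_funs (F 0)"
    unfolding P_def M_def using exp_tail_poly(1)[OF poly_funs.const] y my poly_funs_next by blast+
  define D where "D t = P t * x + x * M t - y * x * y + t *q (y * (x * M t)) - t *q (P t * x * y)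
    + t\<^sup>2 *q (P t * x * M t)" for t
  have m: "(\<lambda>t. f t * g t) \<in> poly_funs (F 0)" if "f \<in> poly_funs (F 0)" "g \<in> poly_funs (F 0)" for f g
    by (rule poly_funs_next[OF poly_funs_mult_same[OF that]])
  define f where "f t = y * x - x * y + t *q D t" for t
  have F0m: "a * b \<in> F 0" if "a \<in> F 0" "b \<in> F 0" for a b
    using mult_same[OF that] decreasing by blast
  have f: "f \<in> poly_funs (F 0)"
    unfolding f_def D_def
    by (intro poly_funs_add poly_funs_diff poly_funs_var poly_funs_var_power m P M subspace
        poly_funs.const F0m x y)
  have conj: "nexp c (t *q y) * x * nexp c (- (t *q y)) = x + t *q f t" for t
  proof -
    have minus: "nexp c (- (t *q y)) = 1 - t *q y + t\<^sup>2 *q M t"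
      using nexp_expand[OF my, of t] by (simp add: M_def)
    show ?thesis
      unfolding nexp_expand[OF y] minus f_def D_def P_def
      by (simp add: distrib_left distrib_right mult_qscale_left mult_qscale_right
          qscale_right_distrib power2_eq_square algebra_simps)
  qed
  have "f t \<in> log_set" if "t \<noteq> 0" for t
  proof -
    have ty: "t *q y \<in> log_set" by (rule log_set_scale[OF assms(2)])
    then have ty0: "t *q y \<in> F 0" by (simp add: log_set_def)
    have "x + t *q f t \<in> F 0"
      using x(1) poly_funs_in[OF f subspace] Q.subspace_add[OF subspace] Q.subspace_scale[OF subspace]
      by blast
    moreover have "nexp c (x + t *q f t) \<in> G"
      unfolding conj[symmetric] nexp_conjugate[OF x(1) ty0]
      using ty log_set_uminus[OF ty] x mult_in by (auto simp: log_set_def)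
    ultimately have "x + t *q f t \<in> log_set" by (simp add: log_set_def)
    then have "(x + t *q f t) - x \<in> log_set"
      using assms(1) by (rule Q.subspace_diff[OF log_set_subspace])
    then have "t *q f t \<in> log_set" by simp
    from log_set_scale[OF this, of "1 / t"] that show ?thesis by simp
  qed
  then have "f 0 \<in> log_set" by (rule poly_funs_value_0[OF f log_set_subspace])
  then show ?thesis by (simp add: f_def)
qed

end

section \<open>Products of algebras\<close>

text \<open>The graph of a homomorphism between unipotent groups is a unipotent group in the product algebra.\<close>

instantiation prod :: (times, times) times
begin
definition times_prod_def: "x * y = (fst x * fst y, snd x * snd y)"
instance ..
end

instantiation prod :: (one, one) one
begin
definition one_prod_def: "1 = (1, 1)"
instance ..
end

instance prod :: (ring_1, ring_1) ring_1
  by standard (auto simp: times_prod_def one_prod_def plus_prod_def zero_prod_def algebra_simps)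

instantiation prod :: (rat_algebra, rat_algebra) rat_algebra
begin
definition qscale_prod_def: "q *q x = (q *q fst x, q *q snd x)"
instance
  by standard (auto simp: qscale_prod_def times_prod_def plus_prod_def qscale_right_distrib
      qscale_left_distrib qscale_qscale qscale_one mult_qscale_left mult_qscale_right)
end

lemma nexp_Pair: "nexp c (x, y) = (nexp c x, nexp c y)"
proof -
  have "(x, y) ^ i = (x ^ i, y ^ i)" for i
    by (induction i) (simp_all add: one_prod_def times_prod_def)
  then show ?thesis
    by (simp add: nexp_def qscale_prod_def prod_eq_iff fst_sum snd_sum)
qed

lemma nilpotent_filtration_prod:
  assumes "nilpotent_filtration F c" "nilpotent_filtration H c"
  shows "nilpotent_filtration (\<lambda>k. F k \<times> H k) c"
proof -
  interpret F: nilpotent_filtration F c by fact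
  interpret H: nilpotent_filtration H c by fact
  show ?thesis
  proof
    show "Q.subspace (F k \<times> H k)" for k
      using F.subspace[of k] H.subspace[of k]
      by (auto simp: Q.subspace_def zero_prod_def plus_prod_def qscale_prod_def)
  next
    show "F (Suc k) \<times> H (Suc k) \<subseteq> F k \<times> H k" for k
      using F.decreasing H.decreasing by blast
  next
    show "x * y \<in> F (Suc (i + j)) \<times> H (Suc (i + j))"
      if "x \<in> F i \<times> H i" "y \<in> F j \<times> H j" for x y i j
      using that F.mult H.mult by (auto simp: times_prod_def)
  next
    show "F c \<times> H c \<subseteq> {0}" using F.vanishing H.vanishing by (auto simp: zero_prod_def)
  qed
qed

section \<open>Finite-dimensional nil algebras are nilpotent\<close>

context vector_space
begin

text \<open>Stated for an indexed family, which may have repetitions.\<close>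

lemma nontrivial_relation:
  fixes x :: "nat \<Rightarrow> 'b"
  assumes "finite S" "\<And>i. i \<le> card S \<Longrightarrow> x i \<in> span S"
  shows "\<exists>a. (\<exists>i\<le>card S. a i \<noteq> 0) \<and> (\<Sum>i\<le>card S. a i *s x i) = 0"
proof (cases "inj_on x {..card S}")
  case False
  then obtain i j where ij: "i \<le> card S" "j \<le> card S" "i \<noteq> j" "x i = x j"
    by (auto simp: inj_on_def)
  define a where "a k = (if k = i then 1 else if k = j then -1 else 0 :: 'a)" for k
  have "(\<Sum>k\<le>card S. a k *s x k) = (\<Sum>k\<in>{i, j}. a k *s x k)"
    by (rule sum.mono_neutral_right) (use ij in \<open>auto simp: a_def\<close>)
  also have "\<dots> = 0" using ij by (simp add: a_def)
  finally show ?thesis using ij by (intro exI[of _ a]) (auto simp: a_def)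
next
  case True
  have "dependent (x ` {..card S})"
  proof (rule ccontr)
    assume "independent (x ` {..card S})"
    from independent_span_bound[OF assms(1) this] assms(2) show False
      by (auto simp: card_image[OF True])
  qed
  then obtain u v where v: "v \<in> {..card S}" "u (x v) \<noteq> 0"
    and 0: "(\<Sum>w\<in>x ` {..card S}. u w *s w) = 0"
    by (auto simp: dependent_finite)
  from 0 have "(\<Sum>i\<le>card S. u (x i) *s x i) = 0"
    by (simp add: sum.reindex[OF True])
  with v show ?thesis by (intro exI[of _ "\<lambda>i. u (x i)"]) auto
qed

end

locale algebra_over_field = vector_space scale
  for scale :: "'k::field \<Rightarrow> 'r::ring_1 \<Rightarrow> 'r" (infixr \<open>*s\<close> 75) +
  assumes mult_scale_left: "(a *s x) * y = a *s (x * y)"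
    and mult_scale_right: "x * (a *s y) = a *s (x * y)"
begin

text \<open>Level \<open>k\<close> is the power with exponent \<open>k + 1\<close>, as in \<^locale>\<open>nilpotent_filtration\<close>.\<close>

primrec ideal_power :: "'r set \<Rightarrow> nat \<Rightarrow> 'r set" where
  "ideal_power I 0 = I"
| "ideal_power I (Suc k) = span {a * b | a b. a \<in> I \<and> b \<in> ideal_power I k}"

declare ideal_power.simps(2) [simp del]

lemma ideal_power_subspace:
  assumes "subspace I"
  shows "subspace (ideal_power I k)"
proof (cases k)
  case 0
  with assms show ?thesis by simp
next
  case (Suc j)
  show ?thesis unfolding Suc ideal_power.simps(2) by (rule subspace_span)
qed

lemma ideal_power_decreasing:
  assumes "subspace I" "\<And>a b. a \<in> I \<Longrightarrow> b \<in> I \<Longrightarrow> a * b \<in> I"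
  shows "ideal_power I (Suc k) \<subseteq> ideal_power I k"
proof (induction k)
  case 0
  have "{a * b | a b. a \<in> I \<and> b \<in> I} \<subseteq> I" using assms(2) by blast
  then have "span {a * b | a b. a \<in> I \<and> b \<in> I} \<subseteq> I" using assms(1) by (rule span_minimal)
  then show ?case by (simp add: ideal_power.simps(2))
next
  case (Suc k)
  have "{a * b | a b. a \<in> I \<and> b \<in> ideal_power I (Suc k)} \<subseteq> {a * b | a b. a \<in> I \<and> b \<in> ideal_power I k}"
    using Suc by blast
  then show ?case unfolding ideal_power.simps(2)[of I k] ideal_power.simps(2)[of I "Suc k"]
    by (rule span_mono)
qed

lemma ideal_power_mult:
  assumes I: "subspace I" "\<And>a b. a \<in> I \<Longrightarrow> b \<in> I \<Longrightarrow> a * b \<in> I"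
    and "x \<in> ideal_power I i" "y \<in> ideal_power I j"
  shows "x * y \<in> ideal_power I (Suc (i + j))"
  using assms(3)
proof (induction i arbitrary: x)
  case 0
  then have "x * y \<in> {a * b | a b. a \<in> I \<and> b \<in> ideal_power I j}" using assms(4) by auto
  then show ?case by (simp add: ideal_power.simps(2) span_base)
next
  case (Suc i)
  from Suc.prems have "x \<in> span {a * b | a b. a \<in> I \<and> b \<in> ideal_power I i}"
    by (simp add: ideal_power.simps(2))
  then show ?case
  proof (induction rule: span_induct_alt)
    case base
    show ?case using subspace_0[OF ideal_power_subspace[OF I(1)]] by simp
  next
    case (step r z w)
    then obtain a b where z: "z = a * b" "a \<in> I" "b \<in> ideal_power I i" by blast
    have "z * y \<in> ideal_power I (Suc (Suc i + j))"
      unfolding add_Suc ideal_power.simps(2)[of I "Suc (i + j)"]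
      by (rule span_base) (use Suc.IH[OF z(3)] z(2) in \<open>auto simp: z(1) mult.assoc\<close>)
    then have "r *s (z * y) + w * y \<in> ideal_power I (Suc (Suc i + j))"
      by (intro subspace_add subspace_scale ideal_power_subspace[OF I(1)] step)
    then show ?case by (simp add: distrib_right mult_scale_left)
  qed
qed

text \<open>The powers are defined with the new factor on the left; by associativity it may as well be
split off on the right.\<close>

lemma ideal_power_Suc_right:
  "ideal_power I (Suc k) \<subseteq> span {a * b | a b. a \<in> ideal_power I k \<and> b \<in> I}"
proof (induction k)
  case (Suc k)
  let ?R = "span {a * b | a b. a \<in> ideal_power I (Suc k) \<and> b \<in> I}"
  have "a * b \<in> ?R" if a: "a \<in> I" and b: "b \<in> ideal_power I (Suc k)" for a b
  proof -
    from b Suc have "b \<in> span {a * b | a b. a \<in> ideal_power I k \<and> b \<in> I}" by blast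
    then show ?thesis
    proof (induction rule: span_induct_alt)
      case base
      show ?case by (simp add: span_zero)
    next
      case (step r z w)
      then obtain p q where z: "z = p * q" "p \<in> ideal_power I k" "q \<in> I" by blast
      have "a * p \<in> ideal_power I (Suc k)"
        unfolding ideal_power.simps(2) by (rule span_base) (use a z in blast)
      then have "a * p * q \<in> ?R" by (intro span_base) (use z in blast)
      then have "r *s (a * z) + a * w \<in> ?R"
        using step by (intro span_add span_scale) (simp_all add: z mult.assoc)
      then show ?case by (simp only: distrib_left mult_scale_right)
    qed
  qed
  then have "{a * b | a b. a \<in> I \<and> b \<in> ideal_power I (Suc k)} \<subseteq> ?R" by blast
  then have "span {a * b | a b. a \<in> I \<and> b \<in> ideal_power I (Suc k)} \<subseteq> ?R"
    by (rule span_minimal) (rule subspace_span)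
  then show ?case by (simp only: ideal_power.simps(2)[of I "Suc k"])
qed (simp add: ideal_power.simps(2))

text \<open>A bound on the dimension in terms of independent sets: a proper subspace has a smaller bound, since
an outside vector can be added to its independent sets.\<close>

definition dim_at_most :: "'r set \<Rightarrow> nat \<Rightarrow> bool" where
  "dim_at_most M d \<longleftrightarrow> (\<forall>B\<subseteq>M. independent B \<longrightarrow> finite B \<and> card B \<le> d)"

lemma dim_at_most_psubset:
  assumes "subspace N" "N \<subset> M" "dim_at_most M (Suc d)"
  shows "dim_at_most N d"
  unfolding dim_at_most_def
proof (intro allI impI)
  fix B assume B: "B \<subseteq> N" "independent B"
  obtain w where w: "w \<in> M" "w \<notin> N" using assms(2) by blast
  have "span B \<subseteq> N" by (rule span_minimal[OF B(1) assms(1)])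
  then have "w \<notin> span B" using w by blast
  then have indep: "independent (insert w B)" and "w \<notin> B"
    using B by (auto simp: independent_insert span_base)
  have "insert w B \<subseteq> M" using w B assms(2) by blast
  with assms(3) indep have "finite (insert w B) \<and> card (insert w B) \<le> Suc d"
    unfolding dim_at_most_def by metis
  then show "finite B \<and> card B \<le> d" using \<open>w \<notin> B\<close> by auto
qed

text \<open>Induction on the dimension of the module \<open>M\<close>. For \<open>x \<in> M\<close> the submodule \<open>I x\<close> is proper, unless
\<open>x = 0\<close>: otherwise \<open>e x = x\<close> for some nilpotent \<open>e \<in> I\<close>. So a power of \<open>I\<close> annihilates \<open>I x\<close>, and
the next power annihilates \<open>x\<close>.\<close>

lemma nil_algebra_annihilates:
  assumes I: "subspace I" "\<And>a b. a \<in> I \<Longrightarrow> b \<in> I \<Longrightarrow> a * b \<in> I"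
    and nil: "\<And>a. a \<in> I \<Longrightarrow> \<exists>k. a ^ k = 0"
    and "subspace M" "\<And>a x. a \<in> I \<Longrightarrow> x \<in> M \<Longrightarrow> a * x \<in> M" "dim_at_most M d"
    and "a \<in> ideal_power I d" "x \<in> M"
  shows "a * x = 0"
  using assms(4-)
proof (induction d arbitrary: M a x)
  case 0
  have "x = 0"
  proof (rule ccontr)
    assume "x \<noteq> 0"
    then have "independent {x}" by simp
    with 0 show False unfolding dim_at_most_def by force
  qed
  then show ?case by simp
next
  case (Suc d)
  define N where "N = (\<lambda>a. a * x) ` I"
  have N: "subspace N"
    unfolding subspace_def
  proof (intro conjI ballI allI)
    show "0 \<in> N" using subspace_0[OF I(1)] unfolding N_def by (rule rev_image_eqI) simp
    show "u + v \<in> N" if uv: "u \<in> N" "v \<in> N" for u v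
    proof -
      obtain a b where "a \<in> I" "b \<in> I" "u = a * x" "v = b * x"
        using uv by (auto simp: N_def)
      then show ?thesis
        using subspace_add[OF I(1), of a b] unfolding N_def
        by (intro rev_image_eqI[of "a + b"]) (auto simp: distrib_right)
    qed
    show "q *s u \<in> N" if u: "u \<in> N" for q u
    proof -
      obtain a where "a \<in> I" "u = a * x" using u by (auto simp: N_def)
      then show ?thesis
        using subspace_scale[OF I(1), of a q] unfolding N_def
        by (intro rev_image_eqI[of "q *s a"]) (auto simp: mult_scale_left)
    qed
  qed
  have NM: "N \<subseteq> M" unfolding N_def using Suc.prems(2)[OF _ Suc.prems(5)] by blast
  have "N \<noteq> M \<or> x = 0"
  proof (cases "x \<in> N")
    case True
    then obtain e where e: "e \<in> I" "e * x = x" by (auto simp: N_def)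
    have "e ^ k * x = x" for k by (induction k) (simp_all add: mult.assoc e)
    moreover obtain k where "e ^ k = 0" using nil[OF e(1)] by blast
    ultimately have "x = 0" by (metis mult_zero_left)
    then show ?thesis ..
  next
    case False
    then show ?thesis using Suc.prems(5) by metis
  qed
  then show ?case
  proof
    assume "N \<noteq> M"
    with NM have "N \<subset> M" by (rule psubsetI)
    with N have *: "dim_at_most N d" by (rule dim_at_most_psubset) (rule Suc.prems(3))
    have zero: "a * (b * x) = 0" if "a \<in> ideal_power I d" "b \<in> I" for a b
    proof (rule Suc.IH[OF N _ * that(1)])
      show "b * x \<in> N" using that by (simp add: N_def)
      show "p * y \<in> N" if "p \<in> I" "y \<in> N" for p y
      proof -
        obtain q where "q \<in> I" "y = q * x" using \<open>y \<in> N\<close> by (auto simp: N_def)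
        then show ?thesis
          using I(2)[of p q] \<open>p \<in> I\<close> unfolding N_def
          by (intro rev_image_eqI[of "p * q"]) (auto simp: mult.assoc)
      qed
    qed
    have "a \<in> span {a * b | a b. a \<in> ideal_power I d \<and> b \<in> I}" using ideal_power_Suc_right Suc.prems(4) by blast
    then show "a * x = 0"
    proof (induction rule: span_induct_alt)
      case (step r z w)
      then obtain p q where "z = p * q" "p \<in> ideal_power I d" "q \<in> I" by blast
      then have "z * x = 0" using zero by (simp add: mult.assoc)
      then show ?case using step by (simp add: distrib_right mult_scale_left)
    qed simp
  qed simp
qed

lemma nil_algebra_nilpotent:
  assumes I: "subspace I" "\<And>a b. a \<in> I \<Longrightarrow> b \<in> I \<Longrightarrow> a * b \<in> I"
    and nil: "\<And>a. a \<in> I \<Longrightarrow> \<exists>k. a ^ k = 0"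
    and fin: "finite S" "I \<subseteq> span S"
  shows "\<exists>k. ideal_power I k = {0}"
proof -
  have "dim_at_most I (card S)"
    unfolding dim_at_most_def
    using independent_span_bound[OF fin(1)] order_trans[OF _ fin(2)] by simp
  then have ann: "a * x = 0" if "a \<in> ideal_power I (card S)" "x \<in> I" for a x
    using nil_algebra_annihilates[OF I nil I] that by blast
  have "{a * b | a b. a \<in> ideal_power I (card S) \<and> b \<in> I} \<subseteq> {0}"
    using ann by blast
  then have "span {a * b | a b. a \<in> ideal_power I (card S) \<and> b \<in> I} \<subseteq> {0}"
    by (rule span_minimal) (simp add: subspace_def)
  with ideal_power_Suc_right have "ideal_power I (Suc (card S)) \<subseteq> {0}" by blast
  moreover have "0 \<in> ideal_power I (Suc (card S))"
    by (rule subspace_0[OF ideal_power_subspace[OF I(1)]])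
  ultimately show ?thesis by blast
qed

end

section \<open>Traces and nilpotency\<close>

definition mtrace :: "'a::comm_ring_1 mat \<Rightarrow> 'a" where
  "mtrace A = (\<Sum>i<dim_row A. A $$ (i, i))"

lemma index_mult_mat_sum:
  assumes "A \<in> carrier_mat n m" "B \<in> carrier_mat m k" "i < n" "j < k"
  shows "(A * B) $$ (i, j) = (\<Sum>l<m. A $$ (i, l) * B $$ (l, j))"
  using assms by (auto simp: scalar_prod_def lessThan_atLeast0 intro!: sum.cong)

lemma mtrace_mult:
  assumes "A \<in> carrier_mat n m" "B \<in> carrier_mat m n"
  shows "mtrace (A * B) = (\<Sum>i<n. \<Sum>l<m. A $$ (i, l) * B $$ (l, i))"
  using assms by (simp add: mtrace_def index_mult_mat_sum del: index_mult_mat(1))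

lemma mtrace_mult_commute:
  assumes "A \<in> carrier_mat n m" "B \<in> carrier_mat m n"
  shows "mtrace (A * B) = mtrace (B * A)"
  unfolding mtrace_mult[OF assms] mtrace_mult[OF assms(2,1)]
  by (subst sum.swap) (simp add: mult.commute)

lemma pow_mat_mult_rotate:
  assumes P: "P \<in> carrier_mat n m" and Q: "Q \<in> carrier_mat m n"
  shows "(P * Q) ^\<^sub>m Suc k = P * ((Q * P) ^\<^sub>m k * Q)"
proof (induction k)
  case 0
  show ?case using P Q by simp
next
  case (Suc k)
  have C: "(Q * P) ^\<^sub>m k \<in> carrier_mat m m" using P Q by (intro pow_carrier_mat) auto
  have "(P * Q) ^\<^sub>m Suc (Suc k) = P * ((Q * P) ^\<^sub>m k * Q) * (P * Q)"
    by (subst pow_mat.simps(2)) (simp only: Suc)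
  also have "\<dots> = P * ((Q * P) ^\<^sub>m k * (Q * P) * Q)"
  proof -
    have CQ: "(Q * P) ^\<^sub>m k * Q \<in> carrier_mat m n" and PQ: "P * Q \<in> carrier_mat n n"
      and QP: "Q * P \<in> carrier_mat m m"
      using P Q C by auto
    show ?thesis
      by (simp only: assoc_mult_mat[OF P CQ PQ] assoc_mult_mat[OF C Q PQ]
          assoc_mult_mat[OF Q P Q, symmetric] assoc_mult_mat[OF C QP Q, symmetric])
  qed
  finally show ?case by simp
qed

text \<open>A matrix \<open>P * Q\<close> and the possibly smaller matrix \<open>Q * P\<close> have the same power traces and are
nilpotent together. For a singular matrix this allows an induction on its size.\<close>

lemma mtrace_power_rotate:
  assumes P: "P \<in> carrier_mat n m" and Q: "Q \<in> carrier_mat m n"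
  shows "mtrace ((P * Q) ^\<^sub>m Suc k) = mtrace ((Q * P) ^\<^sub>m Suc k)"
proof -
  have C: "(Q * P) ^\<^sub>m k \<in> carrier_mat m m" using P Q by (intro pow_carrier_mat) auto
  have "mtrace ((P * Q) ^\<^sub>m Suc k) = mtrace ((Q * P) ^\<^sub>m k * Q * P)"
    unfolding pow_mat_mult_rotate[OF assms] by (rule mtrace_mult_commute[OF P]) (use C Q in auto)
  also have "(Q * P) ^\<^sub>m k * Q * P = (Q * P) ^\<^sub>m Suc k"
    using C P Q by (simp add: assoc_mult_mat[of _ m m _ n _ m])
  finally show ?thesis .
qed

text \<open>A kernel vector \<open>v\<close> with \<open>v $ k \<noteq> 0\<close> expresses column \<open>k\<close> by the other columns. So \<open>P\<close> is \<open>A\<close> without this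
column, and \<open>Q\<close> puts the columns together again.\<close>

lemma singular_mat_factorization:
  fixes A :: "'a::field mat"
  assumes A: "A \<in> carrier_mat (Suc n) (Suc n)" and "det A = 0"
  shows "\<exists>P \<in> carrier_mat (Suc n) n. \<exists>Q \<in> carrier_mat n (Suc n). A = P * Q"
proof -
  obtain v where v: "v \<in> carrier_vec (Suc n)" "v \<noteq> 0\<^sub>v (Suc n)" "A *\<^sub>v v = 0\<^sub>v (Suc n)"
    using assms by (auto simp: det_0_iff_vec_prod_zero_field[OF A])
  then obtain k where k: "k < Suc n" "v $ k \<noteq> 0" by (metis carrier_vecD eq_vecI index_zero_vec)
  let ?r = "insert_index k"
  define P where "P = mat (Suc n) n (\<lambda>(i, j). A $$ (i, ?r j))"
  define Q where "Q = mat n (Suc n) (\<lambda>(j, l). if l = k then - v $ ?r j / v $ k else if ?r j = l then 1 else 0)"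
  have P: "P \<in> carrier_mat (Suc n) n" and Q: "Q \<in> carrier_mat n (Suc n)" by (auto simp: P_def Q_def)
  have reindex: "(\<Sum>j<n. f (?r j)) = (\<Sum>j\<in>{..<Suc n} - {k}. f j)" for f :: "nat \<Rightarrow> 'a"
    using sum.reindex[OF insert_index_inj_on, of f k "{0..<n}"] insert_index_image[OF k(1)]
    by (simp add: lessThan_atLeast0)
  have "A $$ (i, l) = (P * Q) $$ (i, l)" if il: "i < Suc n" "l < Suc n" for i l
  proof (cases "l = k")
    case True
    have "(A *\<^sub>v v) $ i = (\<Sum>j<Suc n. A $$ (i, j) * v $ j)"
      using A v(1) il by (auto simp: scalar_prod_def lessThan_atLeast0 intro!: sum.cong)
    also have "\<dots> = A $$ (i, k) * v $ k + (\<Sum>j\<in>{..<Suc n} - {k}. A $$ (i, j) * v $ j)"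
      by (rule sum.remove) (use k in auto)
    finally have "A $$ (i, k) * v $ k = - (\<Sum>j\<in>{..<Suc n} - {k}. A $$ (i, j) * v $ j)"
      using v(3) il by (simp add: eq_neg_iff_add_eq_0)
    then have "A $$ (i, k) = - (\<Sum>j\<in>{..<Suc n} - {k}. A $$ (i, j) * v $ j) / v $ k"
      using k by (simp add: field_simps)
    also have "\<dots> = (\<Sum>j\<in>{..<Suc n} - {k}. A $$ (i, j) * (- v $ j / v $ k))"
      by (simp add: sum_negf sum_divide_distrib)
    also have "\<dots> = (\<Sum>j<n. A $$ (i, ?r j) * (- v $ ?r j / v $ k))" by (rule reindex[symmetric])
    also have "\<dots> = (P * Q) $$ (i, l)"
      unfolding index_mult_mat_sum[OF P Q il] using il True
      by (intro sum.cong) (auto simp: P_def Q_def)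
    finally show ?thesis using True by simp
  next
    case False
    have "(P * Q) $$ (i, l) = (\<Sum>j<n. A $$ (i, ?r j) * (if ?r j = l then 1 else 0))"
      unfolding index_mult_mat_sum[OF P Q il] using il False
      by (intro sum.cong) (auto simp: P_def Q_def)
    also have "\<dots> = (\<Sum>j\<in>{..<Suc n} - {k}. A $$ (i, j) * (if j = l then 1 else 0))"
      by (rule reindex)
    also have "\<dots> = A $$ (i, l)"
      using il False by (simp add: if_distrib cong: if_cong)
    finally show ?thesis ..
  qed
  then have "A = P * Q" using A P Q by (intro eq_matI) auto
  then show ?thesis using P Q by blast
qed

lemma det_pow_mat:
  assumes "A \<in> carrier_mat n n"
  shows "det (A ^\<^sub>m k) = det A ^ k"
  using assms by (induction k) (auto simp: det_mult[OF pow_carrier_mat])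

lemma nilpotent_mtrace:
  fixes A :: "'a::field mat"
  assumes "A \<in> carrier_mat n n" "A ^\<^sub>m k = 0\<^sub>m n n"
  shows "mtrace A = 0"
  using assms
proof (induction n arbitrary: A k)
  case 0
  then show ?case by (simp add: mtrace_def)
next
  case (Suc n)
  have "det A ^ k = det (0\<^sub>m (Suc n) (Suc n) :: 'a mat)"
    using det_pow_mat[OF Suc.prems(1), of k] Suc.prems(2) by simp
  also have "\<dots> = 0" by simp
  finally have "det A = 0" by simp
  then obtain P Q where P: "P \<in> carrier_mat (Suc n) n" and Q: "Q \<in> carrier_mat n (Suc n)"
    and A: "A = P * Q"
    using singular_mat_factorization[OF Suc.prems(1)] by blast
  have "(Q * P) ^\<^sub>m Suc k = Q * ((P * Q) ^\<^sub>m k * P)" by (rule pow_mat_mult_rotate[OF Q P])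
  also have "\<dots> = 0\<^sub>m n n" using P Q Suc.prems(2) by (simp flip: A)
  finally have zero: "(Q * P) ^\<^sub>m Suc k = 0\<^sub>m n n" .
  have "Q * P \<in> carrier_mat n n" using P Q by auto
  from Suc.IH[OF this zero] have "mtrace (Q * P) = 0" .
  then show ?case using mtrace_power_rotate[OF P Q, of 0] P Q by (simp add: A)
qed

lemma underdetermined_system:
  fixes e :: "nat \<Rightarrow> nat \<Rightarrow> 'a::field"
  shows "\<exists>a. (\<exists>i\<le>N. a i \<noteq> 0) \<and> (\<forall>r<N. (\<Sum>i\<le>N. e r i * a i) = 0)"
proof -
  \<comment> \<open>A zero row makes the system square.\<close>
  define M where "M = mat (Suc N) (Suc N) (\<lambda>(r, i). if r < N then e r i else 0)"
  have M: "M \<in> carrier_mat (Suc N) (Suc N)" by (simp add: M_def)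
  have "transpose_mat M *\<^sub>v unit_vec (Suc N) N = 0\<^sub>v (Suc N)"
    by (rule eq_vecI) (auto simp: M_def)
  moreover have "unit_vec (Suc N) N \<noteq> (0\<^sub>v (Suc N) :: 'a vec)" by simp
  ultimately have "det (transpose_mat M) = 0"
    using M by (subst det_0_iff_vec_prod_zero_field[of _ "Suc N"]) (auto intro!: exI[of _ "unit_vec (Suc N) N"])
  then have "det M = 0" by (simp add: det_transpose[OF M])
  then obtain v where v: "v \<in> carrier_vec (Suc N)" "v \<noteq> 0\<^sub>v (Suc N)" "M *\<^sub>v v = 0\<^sub>v (Suc N)"
    by (auto simp: det_0_iff_vec_prod_zero_field[OF M])
  then obtain k where k: "k < Suc N" "v $ k \<noteq> 0" by (metis carrier_vecD eq_vecI index_zero_vec)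
  have "(\<Sum>i\<le>N. e r i * v $ i) = 0" if r: "r < N" for r
  proof -
    have "(\<Sum>i\<le>N. e r i * v $ i) = (M *\<^sub>v v) $ r"
      using r v(1) M by (auto simp: M_def scalar_prod_def lessThan_Suc_atMost[symmetric]
          lessThan_atLeast0 intro!: sum.cong)
    also have "\<dots> = 0" unfolding v(3) using r by simp
    finally show ?thesis .
  qed
  with k show ?thesis by (intro exI[of _ "\<lambda>i. v $ i"] conjI exI[of _ k]) auto
qed

text \<open>The powers of \<open>A\<close> satisfy a linear relation. If \<open>A\<close> were invertible, the relation could be
multiplied by an inverse power of \<open>A\<close> so that its lowest term becomes a nonzero multiple \<open>a\<close> of the
identity, all others being multiples of positive powers of \<open>A\<close>. Taking traces gives \<open>n a = 0\<close>,
which is impossible in characteristic \<open>0\<close>.\<close>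

lemma mtrace_powers_singular:
  fixes A :: "'a::field_char_0 mat"
  assumes A: "A \<in> carrier_mat n n" and "n > 0" and tr: "\<And>k. mtrace (A ^\<^sub>m Suc k) = 0"
  shows "det A = 0"
proof (rule ccontr)
  assume "det A \<noteq> 0"
  from det_non_zero_imp_unit[OF A this, of "()"]
  obtain B where B: "B \<in> carrier_mat n n" "A * B = 1\<^sub>m n"
    by (auto simp: Units_def ring_mat_def)
  define N where "N = n * n"
  obtain a where a: "\<exists>i\<le>N. a i \<noteq> 0"
    and rel: "\<And>r. r < N \<Longrightarrow> (\<Sum>i\<le>N. (A ^\<^sub>m i) $$ (r div n, r mod n) * a i) = 0"
    using underdetermined_system[of N "\<lambda>r i. (A ^\<^sub>m i) $$ (r div n, r mod n)"] by blast
  have rel': "(\<Sum>i\<le>N. (A ^\<^sub>m i) $$ (r, s) * a i) = 0" if "r < n" "s < n" for r s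
  proof -
    have "r * n + s < Suc r * n" using that by simp
    also have "\<dots> \<le> N" unfolding N_def using that by (intro mult_right_mono) auto
    finally show ?thesis using rel[of "r * n + s"] that by simp
  qed
  define m where "m = (LEAST i. a i \<noteq> 0)"
  have m: "a m \<noteq> 0" "m \<le> N"
    using a LeastI_ex[of "\<lambda>i. a i \<noteq> 0"] Least_le[of "\<lambda>i. a i \<noteq> 0"]
    unfolding m_def by (blast, meson order_trans)
  have low: "a i = 0" if "i < m" for i using that not_less_Least by (auto simp: m_def)
  have Ak: "A ^\<^sub>m k \<in> carrier_mat n n" and Bk: "B ^\<^sub>m k \<in> carrier_mat n n" for k
    using A B by (auto intro: pow_carrier_mat)
  have cancel: "A ^\<^sub>m (j + k) * B ^\<^sub>m k = A ^\<^sub>m j" for j k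
  proof (induction k)
    case 0
    show ?case using A B Ak[of j] by simp
  next
    case (Suc k)
    have BS: "B ^\<^sub>m Suc k = B * B ^\<^sub>m k" using B(1) by (induction k) (simp_all add: assoc_mult_mat[OF B(1) Bk B(1)])
    have "A ^\<^sub>m (j + Suc k) * B ^\<^sub>m Suc k = A ^\<^sub>m (j + k) * A * (B * B ^\<^sub>m k)"
      unfolding BS by (simp only: add_Suc_right pow_mat.simps)
    also have "\<dots> = A ^\<^sub>m (j + k) * (A * B) * B ^\<^sub>m k"
      using A B(1) Ak[of "j + k"] Bk[of k] by (simp add: assoc_mult_mat[of _ n n _ n _ n])
    also have "\<dots> = A ^\<^sub>m j" by (simp only: B(2) right_mult_one_mat[OF Ak] Suc)
    finally show ?case .
  qed
  have "(\<Sum>i\<le>N. mtrace (A ^\<^sub>m i * B ^\<^sub>m m) * a i) =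
      (\<Sum>i\<le>N. \<Sum>r<n. \<Sum>s<n. (A ^\<^sub>m i) $$ (r, s) * a i * (B ^\<^sub>m m) $$ (s, r))"
    unfolding mtrace_mult[OF Ak Bk] sum_distrib_right
    by (intro sum.cong refl) (simp only: mult_ac)
  also have "\<dots> = (\<Sum>r<n. \<Sum>s<n. (\<Sum>i\<le>N. (A ^\<^sub>m i) $$ (r, s) * a i) * (B ^\<^sub>m m) $$ (s, r))"
    unfolding sum_distrib_right by (subst sum.swap, subst (2) sum.swap) simp
  also have "\<dots> = 0" by (simp add: rel')
  finally have "(\<Sum>i\<le>N. mtrace (A ^\<^sub>m i * B ^\<^sub>m m) * a i) = 0" .
  moreover have "mtrace (A ^\<^sub>m i * B ^\<^sub>m m) * a i = (if i = m then of_nat n * a m else 0)" for i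
  proof (cases i m rule: linorder_cases)
    case less
    then show ?thesis by (simp add: low)
  next
    case equal
    then show ?thesis using cancel[of 0 m] A by (simp add: mtrace_def)
  next
    case greater
    then obtain k where "i = Suc k + m" by (metis add.commute less_imp_Suc_add add_Suc_right)
    then show ?thesis using cancel[of "Suc k" m] tr[of k] by simp
  qed
  ultimately have "of_nat n * a m = 0" using m(2) by simp
  then show False using m(1) \<open>n > 0\<close> by simp
qed

lemma mtrace_powers_nilpotent:
  fixes A :: "'a::field_char_0 mat"
  assumes "A \<in> carrier_mat n n" "\<And>k. mtrace (A ^\<^sub>m Suc k) = 0"
  shows "\<exists>k. A ^\<^sub>m k = 0\<^sub>m n n"
  using assms
proof (induction n arbitrary: A)
  case 0
  then have "A ^\<^sub>m 0 = 0\<^sub>m 0 0" by (intro eq_matI) auto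
  then show ?case ..
next
  case (Suc n)
  have "det A = 0" by (rule mtrace_powers_singular[OF Suc.prems(1) _ Suc.prems(2)]) simp
  then obtain P Q where P: "P \<in> carrier_mat (Suc n) n" and Q: "Q \<in> carrier_mat n (Suc n)"
    and A: "A = P * Q"
    using singular_mat_factorization[OF Suc.prems(1)] by blast
  have "mtrace ((Q * P) ^\<^sub>m Suc k) = 0" for k
    using Suc.prems(2)[of k] mtrace_power_rotate[OF P Q, of k] by (simp only: A)
  then obtain k where k: "(Q * P) ^\<^sub>m k = 0\<^sub>m n n" using Suc.IH[of "Q * P"] P Q by auto
  have "A ^\<^sub>m Suc k = P * ((Q * P) ^\<^sub>m k * Q)" unfolding A by (rule pow_mat_mult_rotate[OF P Q])
  also have "\<dots> = 0\<^sub>m (Suc n) (Suc n)" using P Q by (simp add: k)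
  finally show ?case ..
qed

section \<open>Matrices as operators on sequences\<close>

text \<open>The linear operators on sequences form one ring, given by a type, in which the matrix rings of all
sizes are contained, though not as unital subrings. The size \<open>n\<close> of the matrices is a variable in
the theorem, so they have no type of their own with a ring structure.\<close>

typedef (overloaded) 'k lin = "{f :: (nat \<Rightarrow> 'k::field) \<Rightarrow> nat \<Rightarrow> 'k.
    (\<forall>u v. f (\<lambda>i. u i + v i) = (\<lambda>i. f u i + f v i)) \<and>
    (\<forall>a v. f (\<lambda>i. a * v i) = (\<lambda>i. a * f v i))}"
  morphisms app Lin
  by (rule exI[of _ "\<lambda>v. v"]) simp

setup_lifting type_definition_lin

instantiation lin :: (field) ring_1
begin

lift_definition zero_lin :: "'a lin" is "\<lambda>v i. 0" by simp
lift_definition one_lin :: "'a lin" is "\<lambda>v. v" by simp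
lift_definition plus_lin :: "'a lin \<Rightarrow> 'a lin \<Rightarrow> 'a lin" is "\<lambda>f g v i. f v i + g v i"
  by (simp add: algebra_simps)
lift_definition minus_lin :: "'a lin \<Rightarrow> 'a lin \<Rightarrow> 'a lin" is "\<lambda>f g v i. f v i - g v i"
  by (simp add: algebra_simps)
lift_definition uminus_lin :: "'a lin \<Rightarrow> 'a lin" is "\<lambda>f v i. - f v i"
  by simp
lift_definition times_lin :: "'a lin \<Rightarrow> 'a lin \<Rightarrow> 'a lin" is "\<lambda>f g v. f (g v)"
  by simp

instance
proof
  fix a b c :: "'a lin"
  show "(0::'a lin) \<noteq> 1"
    by transfer (metis one_neq_zero)
qed (transfer, simp add: fun_eq_iff algebra_simps)+

end

lift_definition scale_lin :: "'k::field \<Rightarrow> 'k lin \<Rightarrow> 'k lin" is "\<lambda>a f v i. a * f v i"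
  by (simp add: algebra_simps)

interpretation lin: algebra_over_field "scale_lin :: 'k::field \<Rightarrow> 'k lin \<Rightarrow> 'k lin"
  by unfold_locales (transfer, simp add: fun_eq_iff algebra_simps)+

instantiation lin :: (field_char_0) rat_algebra
begin
definition qscale_lin_def: "q *q x = scale_lin (of_rat q) x"
instance
  by standard (simp_all add: qscale_lin_def lin.scale_right_distrib lin.scale_left_distrib
      of_rat_add of_rat_mult lin.mult_scale_left lin.mult_scale_right)
end

lift_definition lin_of_mat :: "'k::field mat \<Rightarrow> 'k lin" is
  "\<lambda>A v i. if i < dim_row A then (\<Sum>j<dim_col A. A $$ (i, j) * v j) else 0"
  by (auto simp: fun_eq_iff sum.distrib[symmetric] sum_distrib_left algebra_simps intro!: sum.cong)

lemma lin_of_mat_entry: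
  assumes "i < dim_row A" "j < dim_col A"
  shows "app (lin_of_mat A) (\<lambda>l. if l = j then 1 else 0) i = A $$ (i, j)"
  using assms by (simp add: lin_of_mat.rep_eq if_distrib cong: if_cong)

lemma lin_of_mat_inject:
  assumes "A \<in> carrier_mat n m" "B \<in> carrier_mat n m"
  shows "lin_of_mat A = lin_of_mat B \<longleftrightarrow> A = B"
proof
  assume eq: "lin_of_mat A = lin_of_mat B"
  show "A = B"
  proof (rule eq_matI)
    fix i j assume "i < dim_row B" "j < dim_col B"
    then show "A $$ (i, j) = B $$ (i, j)"
      using assms lin_of_mat_entry[of i A j] lin_of_mat_entry[of i B j] by (simp add: eq)
  qed (use assms in auto)
qed simp

lemma lin_of_mat_add:
  assumes "A \<in> carrier_mat n m" "B \<in> carrier_mat n m"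
  shows "lin_of_mat (A + B) = lin_of_mat A + lin_of_mat B"
  using assms by transfer (auto simp: fun_eq_iff sum.distrib[symmetric] algebra_simps intro!: sum.cong)

lemma lin_of_mat_smult: "lin_of_mat (a \<cdot>\<^sub>m A) = scale_lin a (lin_of_mat A)"
  by transfer (auto simp: fun_eq_iff sum_distrib_left algebra_simps intro!: sum.cong)

lemma lin_of_mat_0 [simp]: "lin_of_mat (0\<^sub>m n m) = 0"
  by transfer (auto simp: fun_eq_iff)

lemma lin_of_mat_minus:
  assumes "A \<in> carrier_mat n m" "B \<in> carrier_mat n m"
  shows "lin_of_mat (A - B) = lin_of_mat A - lin_of_mat B"
proof -
  have "A - B + B = A" using assms by (intro eq_matI) auto
  moreover have "A - B \<in> carrier_mat n m" using assms by auto
  ultimately show ?thesis using lin_of_mat_add[of "A - B" n m B] assms by (simp add: algebra_simps)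
qed

lemma lin_of_mat_mult:
  assumes "A \<in> carrier_mat n m" "B \<in> carrier_mat m k"
  shows "lin_of_mat (A * B) = lin_of_mat A * lin_of_mat B"
proof -
  have "(\<Sum>j<k. (A * B) $$ (i, j) * v j) = (\<Sum>l<m. A $$ (i, l) * (\<Sum>j<k. B $$ (l, j) * v j))"
    if "i < n" for i and v :: "nat \<Rightarrow> 'a"
  proof -
    have "(\<Sum>j<k. (A * B) $$ (i, j) * v j) = (\<Sum>j<k. \<Sum>l<m. A $$ (i, l) * (B $$ (l, j) * v j))"
      by (intro sum.cong refl)
        (simp add: index_mult_mat_sum[OF assms that] sum_distrib_right mult.assoc del: index_mult_mat(1))
    also have "\<dots> = (\<Sum>l<m. \<Sum>j<k. A $$ (i, l) * (B $$ (l, j) * v j))" by (rule sum.swap)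
    finally show ?thesis by (simp add: sum_distrib_left)
  qed
  then show ?thesis
    using assms by transfer (auto simp: fun_eq_iff simp del: index_mult_mat(1))
qed

lemma lin_of_mat_power:
  assumes "A \<in> carrier_mat n n"
  shows "lin_of_mat (A ^\<^sub>m Suc k) = lin_of_mat A ^ Suc k"
proof (induction k)
  case 0
  show ?case using assms by simp
next
  case (Suc k)
  have "lin_of_mat (A ^\<^sub>m Suc k * A) = lin_of_mat (A ^\<^sub>m Suc k) * lin_of_mat A"
    by (rule lin_of_mat_mult[of _ n n _ n]) (use assms in auto)
  then show ?case using Suc by (simp add: power_commutes mult.assoc)
qed

lemma lin_of_mat_span:
  "\<exists>S. finite S \<and> (lin_of_mat ` carrier_mat n n :: 'k::field lin set) \<subseteq> lin.span S"
proof -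
  define E where "E = (\<lambda>(i, j). lin_of_mat (mat n n (\<lambda>(r, s). if r = i \<and> s = j then 1 else 0)) :: 'k lin)"
  have "lin_of_mat A \<in> lin.span (E ` ({..<n} \<times> {..<n}))" if A: "A \<in> carrier_mat n n" for A
  proof -
    have *: "app (\<Sum>x\<in>T. f x) v i = (\<Sum>x\<in>T. app (f x) v i)" for T and f :: "nat \<times> nat \<Rightarrow> 'k lin" and v i
      by (induction T rule: infinite_finite_induct) (simp_all add: zero_lin.rep_eq plus_lin.rep_eq)
    have "lin_of_mat A = (\<Sum>x\<in>{..<n} \<times> {..<n}. scale_lin (A $$ x) (E x))"
    proof (rule app_inject[THEN iffD1], intro ext)
      fix v i
      have "app (scale_lin (A $$ (r, s)) (E (r, s))) v i = (if r = i then A $$ (r, s) * v s else 0)"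
        if "r < n" "s < n" for r s
      proof -
        have "(if j = s then 1 else 0) * v j = (if j = s then v s else 0)" for j by simp
        then show ?thesis
          using that by (cases "i = r") (simp_all add: E_def scale_lin.rep_eq lin_of_mat.rep_eq)
      qed
      then have "(\<Sum>x\<in>{..<n} \<times> {..<n}. app (scale_lin (A $$ x) (E x)) v i) =
          (\<Sum>(r, s)\<in>{..<n} \<times> {..<n}. if r = i then A $$ (r, s) * v s else 0)"
        by (intro sum.cong) auto
      also have "\<dots> = (\<Sum>r<n. \<Sum>s<n. if r = i then A $$ (r, s) * v s else 0)"
        by (simp add: sum.cartesian_product)
      also have "\<dots> = (\<Sum>r<n. if r = i then \<Sum>s<n. A $$ (i, s) * v s else 0)"
        by (intro sum.cong) auto
      also have "\<dots> = app (lin_of_mat A) v i"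
        using A by (simp add: lin_of_mat.rep_eq)
      finally show "app (lin_of_mat A) v i =
          app (\<Sum>x\<in>{..<n} \<times> {..<n}. scale_lin (A $$ x) (E x)) v i"
        by (simp add: *)
    qed
    also have "\<dots> \<in> lin.span (E ` ({..<n} \<times> {..<n}))"
      by (intro lin.span_sum lin.span_scale lin.span_base) auto
    finally show ?thesis .
  qed
  then show ?thesis by (intro exI[of _ "E ` ({..<n} \<times> {..<n})"]) auto
qed

section \<open>Groups of unipotent matrices\<close>

text \<open>For a matrix group \<open>G\<close>, this is the image of the augmentation ideal of its group ring. It is a ring because
\<open>(g - 1) (h - 1) = (g h - 1) - (g - 1) - (h - 1)\<close>.\<close>

definition augmentation :: "nat \<Rightarrow> 'k::field mat set \<Rightarrow> 'k lin set" where
  "augmentation n G = lin.span ((\<lambda>g. lin_of_mat (g - 1\<^sub>m n)) ` G)"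

text \<open>The generators \<open>g - 1\<close> are nilpotent and thus have trace \<open>0\<close>, a linear condition.\<close>

lemma augmentation_mat:
  assumes "\<And>g. g \<in> G \<Longrightarrow> unipotent_mat n g" "x \<in> augmentation n G"
  shows "\<exists>A \<in> carrier_mat n n. x = lin_of_mat A \<and> mtrace A = 0"
  using assms(2) unfolding augmentation_def
proof (induction rule: lin.span_induct_alt)
  case base
  show ?case by (rule bexI[of _ "0\<^sub>m n n"]) (auto simp: mtrace_def)
next
  case (step a y z)
  then obtain g A where g: "g \<in> G" "y = lin_of_mat (g - 1\<^sub>m n)"
    and A: "A \<in> carrier_mat n n" "z = lin_of_mat A" "mtrace A = 0" by blast
  have u: "unipotent_mat n g" by (rule assms(1)[OF g(1)])
  have gc: "g - 1\<^sub>m n \<in> carrier_mat n n" using u by (auto simp: unipotent_mat_def)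
  have "mtrace (g - 1\<^sub>m n) = 0"
    using u nilpotent_mtrace[OF gc] by (auto simp: unipotent_mat_def)
  then have "mtrace (a \<cdot>\<^sub>m (g - 1\<^sub>m n) + A) = 0"
    using gc A by (simp add: mtrace_def sum.distrib sum_distrib_left[symmetric])
  moreover have "scale_lin a y + z = lin_of_mat (a \<cdot>\<^sub>m (g - 1\<^sub>m n) + A)"
    using gc A by (simp add: g lin_of_mat_add[of _ n n] lin_of_mat_smult)
  ultimately show ?case using gc A by (intro bexI[of _ "a \<cdot>\<^sub>m (g - 1\<^sub>m n) + A"]) auto
qed

lemma augmentation_mult:
  assumes G: "\<And>g. g \<in> G \<Longrightarrow> g \<in> carrier_mat n n" "\<And>g h. g \<in> G \<Longrightarrow> h \<in> G \<Longrightarrow> g * h \<in> G"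
    and "x \<in> augmentation n G" "y \<in> augmentation n G"
  shows "x * y \<in> augmentation n G"
proof -
  let ?e = "\<lambda>g. lin_of_mat (g - 1\<^sub>m n)"
  have gen: "?e g * ?e h \<in> augmentation n G" if "g \<in> G" "h \<in> G" for g h
  proof -
    have c: "g \<in> carrier_mat n n" "h \<in> carrier_mat n n" using that G by auto
    have "lin_of_mat (1\<^sub>m n) * lin_of_mat h = lin_of_mat h" "lin_of_mat g * lin_of_mat (1\<^sub>m n) = lin_of_mat g"
      "lin_of_mat (1\<^sub>m n) * lin_of_mat (1\<^sub>m n) = (lin_of_mat (1\<^sub>m n) :: 'a lin)"
      using c by (simp_all flip: lin_of_mat_mult[of _ n n _ n])
    then have "?e g * ?e h = ?e (g * h) - ?e g - ?e h"
      using c by (simp add: lin_of_mat_minus[of _ n n] lin_of_mat_mult[of _ n n _ n] algebra_simps)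
    then show ?thesis
      unfolding augmentation_def using that G
      by (auto intro!: lin.span_diff intro: lin.span_base)
  qed
  have left: "?e g * y \<in> augmentation n G" if "g \<in> G" for g
    using assms(4) unfolding augmentation_def
  proof (induction rule: lin.span_induct_alt)
    case (step a z w)
    then obtain h where "h \<in> G" "z = ?e h" by blast
    with step gen[OF that] show ?case
      by (simp add: distrib_left lin.mult_scale_right lin.span_add lin.span_scale augmentation_def)
  qed (simp add: lin.span_zero)
  show ?thesis
    using assms(3) unfolding augmentation_def
  proof (induction rule: lin.span_induct_alt)
    case (step a z w)
    then obtain h where "h \<in> G" "z = ?e h" by blast
    with step left show ?case
      by (simp add: distrib_right lin.mult_scale_left lin.span_add lin.span_scale augmentation_def)
  qed (simp add: lin.span_zero)
qed

text \<open>All matrices in the augmentation algebra have trace \<open>0\<close>. With a matrix, all its powers are in this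
algebra, so it is nilpotent because the characteristic is \<open>0\<close>. Hence this is a nil algebra of
finite dimension.\<close>

lemma kolchin:
  fixes G :: "'k::field_char_0 mat set"
  assumes unip: "\<And>g. g \<in> G \<Longrightarrow> unipotent_mat n g"
    and mult: "\<And>g h. g \<in> G \<Longrightarrow> h \<in> G \<Longrightarrow> g * h \<in> G"
  shows "\<exists>k. lin.ideal_power (augmentation n G) k = {0}"
proof -
  let ?I = "augmentation n G"
  have c: "g \<in> carrier_mat n n" if "g \<in> G" for g using unip[OF that] by (simp add: unipotent_mat_def)
  have I_mult: "x * y \<in> ?I" if "x \<in> ?I" "y \<in> ?I" for x y
    by (rule augmentation_mult[OF c mult that])
  have nil: "\<exists>k. x ^ k = 0" if x: "x \<in> ?I" for x
  proof -
    obtain A where A: "A \<in> carrier_mat n n" "x = lin_of_mat A"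
      using augmentation_mat[OF unip x] by blast
    have "mtrace (A ^\<^sub>m Suc k) = 0" for k
    proof -
      have "x ^ Suc k \<in> ?I"
      proof (induction k)
        case (Suc k)
        from I_mult[OF x Suc] show ?case by simp
      qed (simp add: x)
      then obtain B where B: "B \<in> carrier_mat n n" "x ^ Suc k = lin_of_mat B" "mtrace B = 0"
        using augmentation_mat[OF unip] by blast
      have "A ^\<^sub>m Suc k \<in> carrier_mat n n" using A(1) by (rule pow_carrier_mat)
      moreover have "lin_of_mat (A ^\<^sub>m Suc k) = lin_of_mat B"
        using lin_of_mat_power[OF A(1), of k] B(2) A(2) by simp
      ultimately have "A ^\<^sub>m Suc k = B" using B(1) lin_of_mat_inject by blast
      then show ?thesis using B by simp
    qed
    then obtain k where "A ^\<^sub>m k = 0\<^sub>m n n" using mtrace_powers_nilpotent[OF A(1)] by blast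
    then have "A ^\<^sub>m Suc k = 0\<^sub>m n n" using A by simp
    then have "x ^ Suc k = 0" using lin_of_mat_power[OF A(1), of k] A(2) by simp
    then show ?thesis ..
  qed
  obtain S where S: "finite S" "lin_of_mat ` carrier_mat n n \<subseteq> (lin.span S :: 'k lin set)"
    using lin_of_mat_span by blast
  have "?I \<subseteq> lin.span S"
  proof
    fix x assume "x \<in> ?I"
    then obtain A where "A \<in> carrier_mat n n" "x = lin_of_mat A" using augmentation_mat[OF unip] by blast
    then show "x \<in> lin.span S" using S(2) by blast
  qed
  moreover have "lin.subspace ?I" unfolding augmentation_def by (rule lin.subspace_span)
  ultimately show ?thesis using lin.nil_algebra_nilpotent[OF _ I_mult nil S(1)] by blast
qed

lemma lin_subspace_imp_Q:
  "lin.subspace S \<Longrightarrow> Q.subspace S"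
  by (auto simp: lin.subspace_def Q.subspace_def qscale_lin_def)

text \<open>The bound can be enlarged, which permits a common bound for two groups.\<close>

lemma unipotent_group_filtration:
  fixes G :: "'k::field_char_0 mat set"
  assumes unip: "\<And>g. g \<in> G \<Longrightarrow> unipotent_mat n g"
    and mult: "\<And>g h. g \<in> G \<Longrightarrow> h \<in> G \<Longrightarrow> g * h \<in> G"
  shows "\<exists>c. \<forall>d\<ge>c. nilpotent_filtration (lin.ideal_power (augmentation n G)) d"
proof -
  let ?I = "augmentation n G"
  have sub: "lin.subspace ?I" unfolding augmentation_def by (rule lin.subspace_span)
  have m: "a * b \<in> ?I" if "a \<in> ?I" "b \<in> ?I" for a b
    by (rule augmentation_mult[OF _ mult that]) (use unip in \<open>auto simp: unipotent_mat_def\<close>)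
  obtain k where k: "lin.ideal_power ?I k = {0}" using kolchin[OF assms] by blast
  have "nilpotent_filtration (lin.ideal_power ?I) d" if "k \<le> d" for d
  proof
    show "Q.subspace (lin.ideal_power ?I i)" for i
      by (rule lin_subspace_imp_Q[OF lin.ideal_power_subspace[OF sub]])
    show dec: "lin.ideal_power ?I (Suc i) \<subseteq> lin.ideal_power ?I i" for i
      by (rule lin.ideal_power_decreasing[OF sub m])
    show "x * y \<in> lin.ideal_power ?I (Suc (i + j))"
      if "x \<in> lin.ideal_power ?I i" "y \<in> lin.ideal_power ?I j" for x y i j
      by (rule lin.ideal_power_mult[OF sub m that])
    show "lin.ideal_power ?I d \<subseteq> {0}"
      using lift_Suc_antimono_le[of "lin.ideal_power ?I", OF dec \<open>k \<le> d\<close>] k by simp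
  qed
  then show ?thesis by blast
qed

section \<open>Rational points of unipotent groups\<close>

interpretation to_ac: inj_comm_ring_hom to_ac
  by unfold_locales auto

lemma GL_simps [simp]:
  "monoid.mult (GL n) = (*)" "one (GL n) = 1\<^sub>m n"
  by (simp_all add: GL_def units_of_def ring_mat_simps)

lemma GL_carrier:
  "A \<in> carrier (GL n) \<longleftrightarrow> A \<in> carrier_mat n n \<and> (\<exists>B \<in> carrier_mat n n. B * A = 1\<^sub>m n \<and> A * B = 1\<^sub>m n)"
  by (auto simp: GL_def units_of_def Units_def ring_mat_simps)

lemma map_mat_to_ac_hom: "map_mat to_ac \<in> hom (GL n) (GL n)"
proof (rule homI)
  fix A B :: "'a mat"
  assume A: "A \<in> carrier (GL n)" and B: "B \<in> carrier (GL n)"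
  have A': "A \<in> carrier_mat n n" and B': "B \<in> carrier_mat n n" using A B unfolding GL_carrier by blast+
  show "map_mat to_ac (A \<otimes>\<^bsub>GL n\<^esub> B) = map_mat to_ac A \<otimes>\<^bsub>GL n\<^esub> map_mat to_ac B"
    unfolding GL_simps by (rule to_ac.mat_hom_mult[OF A' B'])
  obtain C where C: "C \<in> carrier_mat n n" "C * A = 1\<^sub>m n" "A * C = 1\<^sub>m n"
    using A unfolding GL_carrier by blast
  have "map_mat to_ac C * map_mat to_ac A = 1\<^sub>m n"
    using to_ac.mat_hom_mult[OF C(1) A'] unfolding C(2) to_ac.mat_hom_one by (rule sym)
  moreover have "map_mat to_ac A * map_mat to_ac C = 1\<^sub>m n"
    using to_ac.mat_hom_mult[OF A' C(1)] unfolding C(3) to_ac.mat_hom_one by (rule sym)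
  moreover have "map_mat to_ac A \<in> carrier_mat n n" "map_mat to_ac C \<in> carrier_mat n n"
    using A' C(1) by simp_all
  ultimately show "map_mat to_ac A \<in> carrier (GL n)" unfolding GL_carrier by blast
qed

lemma group_rational_points:
  assumes "subgroup U (GL n)"
  shows "group (rational_points n U)"
proof -
  interpret GL: group "GL n :: 'a mat monoid" by (rule group_GL)
  interpret h: group_hom "GL n :: 'a mat monoid" "GL n" "map_mat to_ac"
    by (intro group_hom.intro group_hom_axioms.intro group_GL map_mat_to_ac_hom)
  interpret U: subgroup U "GL n" by fact
  have "subgroup {A \<in> carrier (GL n). map_mat to_ac A \<in> U} (GL n)"
    by (rule subgroup.intro) (use h.hom_mult h.hom_one h.hom_inv in \<open>auto simp del: GL_simps\<close>)
  then show ?thesis unfolding rational_points_def by (rule GL.subgroup_imp_group)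
qed

lemma rational_points_simps [simp]:
  "monoid.mult (rational_points n U) = (*)" "one (rational_points n U) = 1\<^sub>m n"
  by (simp_all add: rational_points_def)

lemma rational_point_carrier_mat:
  "g \<in> carrier (rational_points n U) \<Longrightarrow> g \<in> carrier_mat n n"
  by (simp add: rational_points_def GL_carrier)

lemma rational_point_unipotent:
  assumes "unipotent_algebraic_group n U" "g \<in> carrier (rational_points n U)"
  shows "unipotent_mat n g"
proof -
  have g: "g \<in> carrier_mat n n" by (rule rational_point_carrier_mat[OF assms(2)])
  have "map_mat to_ac g \<in> U" using assms(2) by (simp add: rational_points_def)
  then obtain k where k: "(map_mat to_ac g - 1\<^sub>m n) ^\<^sub>m k = 0\<^sub>m n n"
    using assms(1) by (auto simp: unipotent_algebraic_group_def unipotent_mat_def)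
  have "map_mat to_ac (g - 1\<^sub>m n) = map_mat to_ac g - 1\<^sub>m n"
    using g by (intro eq_matI) auto
  moreover have "g - 1\<^sub>m n \<in> carrier_mat n n" by (rule minus_carrier_mat) simp
  moreover have "map_mat to_ac (0\<^sub>m n n :: 'a mat) = 0\<^sub>m n n" by (intro eq_matI) auto
  ultimately have "map_mat to_ac ((g - 1\<^sub>m n) ^\<^sub>m k) = map_mat to_ac (0\<^sub>m n n)"
    using k to_ac.mat_hom_pow[of "g - 1\<^sub>m n" n k] by simp
  then have "(g - 1\<^sub>m n) ^\<^sub>m k = 0\<^sub>m n n" by (rule to_ac.mat_hom_inj)
  with g show ?thesis by (auto simp: unipotent_mat_def)
qed

text \<open>Continues \<open>g\<close> by the identity outside of the first \<open>n\<close> coordinates. Unlike \<^const>\<open>lin_of_mat\<close>, this map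
preserves the unit.\<close>

definition unit_lin :: "nat \<Rightarrow> 'k::field mat \<Rightarrow> 'k lin" where
  "unit_lin n g = 1 + lin_of_mat (g - 1\<^sub>m n)"

lemma unit_lin_one [simp]: "unit_lin n (1\<^sub>m n) = 1"
proof -
  have "1\<^sub>m n - 1\<^sub>m n = (0\<^sub>m n n :: 'a mat)" by (intro eq_matI) auto
  then show ?thesis by (simp only: unit_lin_def lin_of_mat_0 add_0_right)
qed

lemma unit_lin_mult:
  assumes "g \<in> carrier_mat n n" "h \<in> carrier_mat n n"
  shows "unit_lin n (g * h) = unit_lin n g * unit_lin n h"
proof -
  have "lin_of_mat (1\<^sub>m n) * lin_of_mat h = lin_of_mat h" "lin_of_mat g * lin_of_mat (1\<^sub>m n) = lin_of_mat g"
    "lin_of_mat (1\<^sub>m n) * lin_of_mat (1\<^sub>m n) = (lin_of_mat (1\<^sub>m n) :: 'a lin)"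
    using assms by (simp_all flip: lin_of_mat_mult[of _ n n _ n])
  then show ?thesis
    using assms by (simp add: unit_lin_def lin_of_mat_minus[of _ n n] lin_of_mat_mult[of _ n n _ n]
        algebra_simps)
qed

lemma unit_lin_pow:
  assumes "g \<in> carrier_mat n n"
  shows "unit_lin n (g ^\<^sub>m k) = unit_lin n g ^ k"
  using assms by (induction k) (simp_all add: unit_lin_mult power_commutes)

lemma unit_lin_inject:
  assumes "g \<in> carrier_mat n n" "h \<in> carrier_mat n n"
  shows "unit_lin n g = unit_lin n h \<longleftrightarrow> g = h"
  using lin_of_mat_inject[OF assms] assms by (simp add: unit_lin_def lin_of_mat_minus[of _ n n])

lemma unit_lin_plus_one:
  assumes "A \<in> carrier_mat n n"
  shows "unit_lin n (1\<^sub>m n + A) = 1 + lin_of_mat A"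
proof -
  have "1\<^sub>m n + A - 1\<^sub>m n = A" using assms by (intro eq_matI) auto
  then show ?thesis by (simp add: unit_lin_def)
qed

lemma poly_to_ac: "poly (map_poly to_ac q) (to_ac t) = to_ac (poly q t)"
  by (induction q) (simp_all add: map_poly_pCons)

lemma eval_entries_poly:
  fixes H :: "'a::field \<Rightarrow> 'a mat"
  assumes p: "p \<in> entry_polys n"
    and H: "\<And>i j. i < n \<Longrightarrow> j < n \<Longrightarrow> \<exists>q. \<forall>t. H t $$ (i, j) = poly q t" "\<And>t. H t \<in> carrier_mat n n"
  shows "\<exists>q. \<forall>t. eval_entries p (map_mat to_ac (H t)) = poly q (to_ac t)"
proof -
  have "\<exists>q. \<forall>v \<in> {..<n} \<times> {..<n}. \<forall>t. H t $$ v = poly (q v) t"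
    by (rule bchoice) (use H(1) in auto)
  then obtain q where q: "\<And>i j t. i < n \<Longrightarrow> j < n \<Longrightarrow> H t $$ (i, j) = poly (q (i, j)) t" by auto
  define Q where "Q = (\<Sum>m \<in> Poly_Mapping.keys p. [:Poly_Mapping.lookup p m:] *
        (\<Prod>v \<in> Poly_Mapping.keys m. (map_poly to_ac (q v)) ^ Poly_Mapping.lookup m v))"
  have "eval_entries p (map_mat to_ac (H t)) = poly Q (to_ac t)" for t
    unfolding eval_entries_def Q_def poly_sum poly_mult poly_prod poly_power
  proof (intro sum.cong refl arg_cong2[where f = "(*)"] prod.cong arg_cong2[where f = power])
    fix m v assume m: "m \<in> Poly_Mapping.keys p" and v: "v \<in> Poly_Mapping.keys m"
    then have "v \<in> {..<n} \<times> {..<n}" using p by (auto simp: entry_polys_def)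
    then obtain i j where "v = (i, j)" "i < n" "j < n" by auto
    then show "map_mat to_ac (H t) $$ v = poly (map_poly to_ac (q v)) (to_ac t)"
      using q[of i j t] H(2)[of t] by (simp add: poly_to_ac)
  qed simp
  then show ?thesis by blast
qed

lemma poly_zero_on_nats:
  fixes q :: "'a::field_char_0 poly"
  assumes "\<And>k. poly q (of_nat k) = 0"
  shows "q = 0"
proof (rule ccontr)
  assume "q \<noteq> 0"
  then have "finite {x. poly q x = 0}" by (rule poly_roots_finite)
  moreover have "range of_nat \<subseteq> {x. poly q x = 0}" using assms by auto
  ultimately have "finite (range (of_nat :: nat \<Rightarrow> 'a))" by (rule finite_subset[rotated])
  moreover have "inj (of_nat :: nat \<Rightarrow> 'a)" by (rule injI) simp
  ultimately show False using range_inj_infinite by blast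
qed

lemma nexp_entry_poly:
  "\<exists>q. \<forall>t. app (nexp d (scale_lin t x)) v i = poly q t" for x :: "'k::field_char_0 lin"
proof -
  have pow: "scale_lin t x ^ k = scale_lin (t ^ k) (x ^ k)" for t k
    by (induction k) (simp_all add: lin.mult_scale_left lin.mult_scale_right mult.commute)
  have sum: "app (\<Sum>k\<in>T. f k) v i = (\<Sum>k\<in>T. app (f k) v i)" for T and f :: "nat \<Rightarrow> 'k lin"
    by (induction T rule: infinite_finite_induct) (simp_all add: zero_lin.rep_eq plus_lin.rep_eq)
  have "app (nexp d (scale_lin t x)) v i =
      poly (\<Sum>k\<le>d. monom (of_rat (1 / fact k) * app (x ^ k) v i) k) t" for t
    by (simp add: nexp_def qscale_lin_def pow sum scale_lin.rep_eq poly_sum poly_monom mult_ac)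
  then show ?thesis by blast
qed

text \<open>A one-parameter group \<open>t \<mapsto> exp (t x)\<close> through a rational point \<open>g = exp x\<close> consists of rational points:
its entries are polynomials in \<open>t\<close>, and so each equation of \<open>U\<close> becomes a polynomial in \<open>t\<close>. It vanishes
at every natural number \<open>k\<close>, where \<open>exp (k x) = g ^ k\<close>, and hence identically.\<close>

lemma rational_points_log_scale:
  fixes U :: "'a::field_char_0 alg_closure mat set" and n :: nat
  defines "G \<equiv> carrier (rational_points n U)"
  assumes U: "unipotent_algebraic_group n U"
    and F: "nilpotent_filtration (lin.ideal_power (augmentation n G)) d"
    and x: "x \<in> augmentation n G" and g: "g \<in> G" "nexp d x = unit_lin n g"
  shows "\<exists>h \<in> G. nexp d (scale_lin t x) = unit_lin n h"
proof -
  interpret nilpotent_filtration "lin.ideal_power (augmentation n G)" d by (rule F)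
  have sub: "subgroup U (GL n)" and closed: "zariski_closed n U"
    using U by (auto simp: unipotent_algebraic_group_def linear_algebraic_group_def)
  interpret G: group "rational_points n U" by (rule group_rational_points[OF sub])
  have Gm: "g \<in> carrier_mat n n" if "g \<in> G" for g
    using rational_point_carrier_mat that unfolding G_def .
  have sx: "scale_lin t x \<in> augmentation n G" for t
    using x unfolding augmentation_def by (rule lin.span_scale)
  have "\<exists>A \<in> carrier_mat n n. nexp d (scale_lin t x) - 1 = lin_of_mat A" for t
    using augmentation_mat[OF _ nexp_in[of "scale_lin t x", simplified, OF sx]]
      rational_point_unipotent[OF U] by (fastforce simp: G_def)
  then obtain A where A: "\<And>t. A t \<in> carrier_mat n n" "\<And>t. nexp d (scale_lin t x) - 1 = lin_of_mat (A t)"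
    by metis
  define H where "H t = 1\<^sub>m n + A t" for t
  have Hc: "H t \<in> carrier_mat n n" for t using A by (simp add: H_def)
  have exp_H: "nexp d (scale_lin t x) = unit_lin n (H t)" for t
    unfolding H_def using unit_lin_plus_one[OF A(1)] by (simp flip: A(2))
  have H_nat: "H (of_nat k) \<in> G" for k
  proof -
    have gk: "g ^\<^sub>m k \<in> G"
    proof (induction k)
      case 0
      show ?case using G.one_closed Gm[OF g(1)] by (simp add: G_def)
    next
      case (Suc k)
      then show ?case using G.m_closed[of "g ^\<^sub>m k" g] g by (simp add: G_def)
    qed
    have "nexp d (scale_lin (of_nat k) x) = nexp d x ^ k"
      using nexp_of_nat_scale[of x k] x by (simp add: qscale_lin_def)
    then have "unit_lin n (H (of_nat k)) = unit_lin n (g ^\<^sub>m k)"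
      by (simp add: exp_H[symmetric] g unit_lin_pow[OF Gm])
    then have "H (of_nat k) = g ^\<^sub>m k" using unit_lin_inject Hc gk Gm by blast
    then show ?thesis using gk by simp
  qed
  have H_inv: "H t * H (- t) = 1\<^sub>m n" for t
  proof -
    have "scale_lin (- t) x = - scale_lin t x" by simp
    then have "unit_lin n (H t * H (- t)) = 1"
      using nexp_minus(1)[of "scale_lin t x"] sx
      by (simp add: unit_lin_mult[OF Hc Hc] exp_H[symmetric])
    then have "unit_lin n (H t * H (- t)) = unit_lin n (1\<^sub>m n)" by simp
    moreover have "H t * H (- t) \<in> carrier_mat n n" by (rule mult_carrier_mat[OF Hc Hc])
    ultimately show ?thesis using unit_lin_inject one_carrier_mat by blast
  qed
  have HGL: "H t \<in> carrier (GL n)" for t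
    unfolding GL_carrier using Hc H_inv[of t] H_inv[of "- t"] by auto
  obtain S where S: "S \<subseteq> entry_polys n" "U = {A \<in> carrier (GL n). \<forall>p \<in> S. eval_entries p A = 0}"
    using closed by (auto simp: zariski_closed_def)
  have entry: "\<exists>q. \<forall>t. H t $$ (i, j) = poly q t" if ij: "i < n" "j < n" for i j
  proof -
    define e :: "nat \<Rightarrow> 'a" where "e = (\<lambda>l. if l = j then 1 else 0)"
    obtain q where q: "\<And>t. app (nexp d (scale_lin t x)) e i = poly q t"
      using nexp_entry_poly[of d x e i] by blast
    have "H t $$ (i, j) = poly q t" for t
    proof -
      have "app (lin_of_mat (A t)) e i = A t $$ (i, j)"
        using lin_of_mat_entry[of i "A t" j] A(1)[of t] ij by (simp add: e_def)
      moreover have "app (lin_of_mat (A t)) e i = poly q t - e i"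
        by (simp add: A(2)[symmetric] minus_lin.rep_eq one_lin.rep_eq q)
      moreover have "H t $$ (i, j) = e i + A t $$ (i, j)"
        using ij A(1)[of t] by (simp add: H_def e_def)
      ultimately show ?thesis by (simp add: algebra_simps)
    qed
    then show ?thesis by blast
  qed
  have "eval_entries p (map_mat to_ac (H t)) = 0" if p: "p \<in> S" for p
  proof -
    obtain q where q: "\<And>t. eval_entries p (map_mat to_ac (H t)) = poly q (to_ac t)"
      using eval_entries_poly[OF _ entry Hc] p S(1) by blast
    have "poly q (of_nat k) = 0" for k
      using H_nat[of k] S(2) p q[of "of_nat k"] by (auto simp: G_def rational_points_def)
    then have "q = 0" by (rule poly_zero_on_nats)
    then show ?thesis by (simp add: q)
  qed
  moreover have "map_mat to_ac (H t) \<in> carrier (GL n)"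
    using HGL[of t] map_mat_to_ac_hom by (auto simp: hom_def)
  ultimately have "H t \<in> G" using HGL[of t] by (simp add: G_def rational_points_def S(2))
  then show ?thesis using exp_H by blast
qed

section \<open>Balanced commutators\<close>

context algebra_over_field
begin

text \<open>Let \<open>Z\<close> be the centralizer of the image of \<open>d\<close>. If \<open>\<Sum>i. a i *s d (x i)\<close> is in \<open>Z\<close>, then so is
\<open>\<Sum>i. a i *s d (act t (x i))\<close>, since \<open>balanced\<close> moves \<open>t\<close> to the other argument of the commutator. Hence
\<open>d x \<mapsto> d (act t x)\<close> induces an operator on the span of the image of \<open>d\<close> modulo \<open>Z\<close>, and these
operators are a representation of the field on a space of finite dimension. By \<open>no_hom\<close> it is zero, but
\<open>1\<close> acts as the identity; so the space is zero and the image of \<open>d\<close> is in \<open>Z\<close>.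

The quotient space is not formed: \<open>indep N u\<close> says that \<open>d (u 0), ..., d (u (N - 1))\<close> are
linearly independent modulo \<open>Z\<close>, and a family of maximal length serves as a basis.\<close>

lemma balanced_family_commutes:
  fixes d :: "'x \<Rightarrow> 'r" and L :: "'x set" and act :: "'l::field \<Rightarrow> 'x \<Rightarrow> 'x"
  assumes no_hom: "\<And>N (f :: 'l \<Rightarrow> 'k mat). nonunital_ring_hom_mat N f \<Longrightarrow> f = (\<lambda>_. 0\<^sub>m N N)"
    and fin: "finite S" "d ` L \<subseteq> span S"
    and act: "\<And>t x. x \<in> L \<Longrightarrow> act t x \<in> L"
    and act_1: "\<And>x. x \<in> L \<Longrightarrow> act 1 x = x"
    and act_mult: "\<And>s t x. x \<in> L \<Longrightarrow> act (s * t) x = act s (act t x)"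
    and d_add: "\<And>s t x. x \<in> L \<Longrightarrow> d (act (s + t) x) = d (act s x) + d (act t x)"
    and balanced: "\<And>t x y. x \<in> L \<Longrightarrow> y \<in> L \<Longrightarrow>
      d (act t x) * d y - d y * d (act t x) = d x * d (act t y) - d (act t y) * d x"
    and "x \<in> L" "y \<in> L"
  shows "d x * d y = d y * d x"
proof -
  define Z where "Z = {z. \<forall>y \<in> L. z * d y = d y * z}"
  have Z: "subspace Z"
    by (auto simp: subspace_def Z_def distrib_left distrib_right mult_scale_left mult_scale_right)
  define indep where "indep N u \<longleftrightarrow> (\<forall>i<N. u i \<in> L) \<and>
    (\<forall>a. (\<Sum>i<N. a i *s d (u i)) \<in> Z \<longrightarrow> (\<forall>i<N. a i = 0))" for N and u :: "nat \<Rightarrow> 'x"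
  have bound: "N \<le> card S" if "indep N u" for N u
  proof (rule ccontr)
    assume "\<not> N \<le> card S"
    then have less: "Suc (card S) \<le> N" by simp
    have "d (u i) \<in> span S" if "i \<le> card S" for i
      using \<open>indep N u\<close> that less fin(2) by (force simp: indep_def)
    from nontrivial_relation[of S "\<lambda>i. d (u i)", OF fin(1) this]
    obtain a where a: "(\<exists>i\<le>card S. a i \<noteq> 0) \<and> (\<Sum>i\<le>card S. a i *s d (u i)) = 0" ..
    have "(\<Sum>i<N. (if i \<le> card S then a i else 0) *s d (u i)) = (\<Sum>i\<le>card S. a i *s d (u i))"
      by (rule sum.mono_neutral_cong_right) (use less in auto)
    then have in_Z: "(\<Sum>i<N. (if i \<le> card S then a i else 0) *s d (u i)) \<in> Z"
      using a subspace_0[OF Z] by metis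
    obtain i where i: "i \<le> card S" "a i \<noteq> 0" using a by blast
    have all_0: "\<forall>i<N. (if i \<le> card S then a i else 0) = 0"
      using \<open>indep N u\<close> unfolding indep_def
      by (elim conjE allE[where x = "\<lambda>i. if i \<le> card S then a i else 0"] mp) (rule in_Z)
    have "(if i \<le> card S then a i else 0) = 0" by (rule all_0[rule_format]) (use i(1) less in simp)
    then show False using i by simp
  qed
  have "indep 0 undefined" by (simp add: indep_def)
  then have "\<exists>N. (\<exists>u. indep N u) \<and> (\<forall>M. (\<exists>u. indep M u) \<longrightarrow> M \<le> N)"
    using ex_has_greatest_nat[of "\<lambda>N. \<exists>u. indep N u" 0 id "Suc (card S)"] bound
    by (force simp: less_Suc_eq_le)
  then obtain N u where u: "indep N u" and max: "\<And>v. \<not> indep (Suc N) v"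
    by (metis Suc_n_not_le_n)
  have uL: "u i \<in> L" if "i < N" for i using u that by (simp add: indep_def)
  have zero: "a i = 0" if "(\<Sum>i<N. a i *s d (u i)) \<in> Z" "i < N" for a i
    using u that by (simp add: indep_def)
  have spanning: "\<exists>a. d x - (\<Sum>i<N. a i *s d (u i)) \<in> Z" if x: "x \<in> L" for x
  proof -
    from max[of "u(N := x)"] obtain a where a: "(\<Sum>i<Suc N. a i *s d ((u(N := x)) i)) \<in> Z"
      "\<not> (\<forall>i<Suc N. a i = 0)"
      using uL x unfolding indep_def by (auto simp: less_Suc_eq)
    have sum: "(\<Sum>i<Suc N. a i *s d ((u(N := x)) i)) = (\<Sum>i<N. a i *s d (u i)) + a N *s d x"
      by simp
    have aN: "a N \<noteq> 0"
    proof
      assume "a N = 0"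
      then have "\<forall>i<N. a i = 0" using a(1) zero unfolding sum by simp
      with \<open>a N = 0\<close> a(2) show False by (auto simp: less_Suc_eq)
    qed
    have "inverse (a N) *s ((\<Sum>i<N. a i *s d (u i)) + a N *s d x) \<in> Z"
      using a(1) unfolding sum by (rule subspace_scale[OF Z])
    also have "inverse (a N) *s ((\<Sum>i<N. a i *s d (u i)) + a N *s d x) =
        d x - (\<Sum>i<N. (- (inverse (a N) * a i)) *s d (u i))"
      using aN by (simp add: scale_right_distrib scale_sum_right sum_negf)
    finally show ?thesis by (intro exI[of _ "\<lambda>i. - (inverse (a N) * a i)"])
  qed
  have shift: "d (act t x) - (\<Sum>i<N. a i *s d (act t (u i))) \<in> Z"
    if x: "x \<in> L" and a: "d x - (\<Sum>i<N. a i *s d (u i)) \<in> Z" for t x a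
    unfolding Z_def
  proof (clarify)
    fix y assume y: "y \<in> L"
    define br where "br p q = p * q - q * p" for p q :: 'r
    have lin: "br (p - (\<Sum>i<N. a i *s e i)) q = br p q - (\<Sum>i<N. a i *s br (e i) q)" for p q e
      by (simp add: br_def left_diff_distrib right_diff_distrib sum_distrib_left sum_distrib_right
          mult_scale_left mult_scale_right scale_right_diff_distrib sum_subtractf)
    have "br (d (act t x) - (\<Sum>i<N. a i *s d (act t (u i)))) (d y) =
        br (d x) (d (act t y)) - (\<Sum>i<N. a i *s br (d (u i)) (d (act t y)))"
      unfolding lin using balanced[OF x y] balanced[OF uL y] by (simp add: br_def)
    also have "\<dots> = br (d x - (\<Sum>i<N. a i *s d (u i))) (d (act t y))" by (simp only: lin)
    also have "\<dots> = 0" using a act[OF y] by (simp add: Z_def br_def)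
    finally show "(d (act t x) - (\<Sum>i<N. a i *s d (act t (u i)))) * d y =
        d y * (d (act t x) - (\<Sum>i<N. a i *s d (act t (u i))))" by (simp add: br_def)
  qed
  have "\<forall>t. \<forall>j. \<exists>a. j < N \<longrightarrow> d (act t (u j)) - (\<Sum>i<N. a i *s d (u i)) \<in> Z"
    using spanning act uL by blast
  then obtain c where c: "\<And>t j. j < N \<Longrightarrow> d (act t (u j)) - (\<Sum>i<N. c t j i *s d (u i)) \<in> Z"
    by metis
  have unique: "c t j i = a i"
    if "j < N" "i < N" "d (act t (u j)) - (\<Sum>i<N. a i *s d (u i)) \<in> Z" for t j i a
  proof -
    have "(d (act t (u j)) - (\<Sum>i<N. a i *s d (u i))) - (d (act t (u j)) - (\<Sum>i<N. c t j i *s d (u i))) \<in> Z"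
      by (rule subspace_diff[OF Z that(3) c[OF that(1)]])
    then have "(\<Sum>i<N. (c t j i - a i) *s d (u i)) \<in> Z"
      by (simp add: scale_left_diff_distrib sum_subtractf)
    from zero[OF this that(2)] show ?thesis by simp
  qed
  \<comment> \<open>Coordinates of images of basis vectors form the columns; with rows, \<open>f\<close> would reverse products.\<close>
  define f where "f t = mat N N (\<lambda>(i, j). c t j i)" for t
  have "nonunital_ring_hom_mat N f"
    unfolding nonunital_ring_hom_mat_def
  proof (intro conjI allI)
    fix s t
    show "f s \<in> carrier_mat N N" by (simp add: f_def)
    show "f (s + t) = f s + f t"
    proof (rule eq_matI)
      fix i j assume "i < dim_row (f s + f t)" "j < dim_col (f s + f t)"
      then have ij: "i < N" "j < N" by (simp_all add: f_def)
      have "(d (act s (u j)) - (\<Sum>i<N. c s j i *s d (u i))) +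
          (d (act t (u j)) - (\<Sum>i<N. c t j i *s d (u i))) \<in> Z"
        by (intro subspace_add[OF Z] c ij)
      then have "d (act (s + t) (u j)) - (\<Sum>i<N. (c s j i + c t j i) *s d (u i)) \<in> Z"
        by (simp add: d_add[OF uL] ij scale_left_distrib sum.distrib algebra_simps)
      from unique[OF ij(2,1) this] show "f (s + t) $$ (i, j) = (f s + f t) $$ (i, j)"
        using ij by (simp add: f_def)
    qed (simp_all add: f_def)
    show "f (s * t) = f s * f t"
    proof (rule eq_matI)
      fix i j assume "i < dim_row (f s * f t)" "j < dim_col (f s * f t)"
      then have ij: "i < N" "j < N" by (simp_all add: f_def)
      have "d (act s (act t (u j))) - (\<Sum>l<N. c t j l *s d (act s (u l))) \<in> Z"
        by (rule shift[OF act[OF uL[OF ij(2)]] c[OF ij(2)]])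
      moreover have "(\<Sum>l<N. c t j l *s (d (act s (u l)) - (\<Sum>i<N. c s l i *s d (u i)))) \<in> Z"
        by (intro subspace_sum[OF Z] subspace_scale[OF Z] c) auto
      ultimately have "(d (act s (act t (u j))) - (\<Sum>l<N. c t j l *s d (act s (u l)))) +
          (\<Sum>l<N. c t j l *s (d (act s (u l)) - (\<Sum>i<N. c s l i *s d (u i)))) \<in> Z"
        by (rule subspace_add[OF Z])
      also have "(d (act s (act t (u j))) - (\<Sum>l<N. c t j l *s d (act s (u l)))) +
          (\<Sum>l<N. c t j l *s (d (act s (u l)) - (\<Sum>i<N. c s l i *s d (u i)))) =
          d (act (s * t) (u j)) - (\<Sum>l<N. \<Sum>i<N. (c s l i * c t j l) *s d (u i))"
        by (simp add: act_mult[OF uL[OF ij(2)]] scale_right_diff_distrib sum_subtractf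
            scale_sum_right mult.commute)
      also have "(\<Sum>l<N. \<Sum>i<N. (c s l i * c t j l) *s d (u i)) =
          (\<Sum>i<N. (\<Sum>l<N. c s l i * c t j l) *s d (u i))"
        by (subst sum.swap) (simp add: scale_sum_left)
      finally have "c (s * t) j i = (\<Sum>l<N. c s l i * c t j l)" by (rule unique[OF ij(2,1)])
      also have "\<dots> = (f s * f t) $$ (i, j)"
        using ij by (subst index_mult_mat_sum[of _ N N _ N]) (auto simp: f_def)
      finally show "f (s * t) $$ (i, j) = (f s * f t) $$ (i, j)" using ij by (simp add: f_def)
    qed (simp_all add: f_def)
  qed
  then have f0: "f = (\<lambda>_. 0\<^sub>m N N)" by (rule no_hom)
  have "N = 0"
  proof (rule ccontr)
    assume "N \<noteq> 0"
    then have N: "0 < N" by simp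
    have "(\<Sum>i<N. (if i = 0 then 1 else 0) *s d (u i)) = d (u 0)"
      using N by (simp add: if_distrib[of "\<lambda>a. a *s _"] cong: if_cong)
    then have "c 1 0 0 = 1"
      using unique[OF N N, of 1 "\<lambda>i. if i = 0 then 1 else 0"] act_1[OF uL[OF N]] subspace_0[OF Z] by simp
    moreover have "c 1 0 0 = f 1 $$ (0, 0)" using N by (simp add: f_def)
    ultimately show False using N by (simp add: f0)
  qed
  with spanning[OF \<open>x \<in> L\<close>] have "d x \<in> Z" by simp
  with \<open>y \<in> L\<close> show ?thesis by (simp add: Z_def)
qed

end

section \<open>Homomorphisms between unipotent groups\<close>

theorem theorem1p1:
  fixes U :: "'a::field_char_0 alg_closure mat set"
    and V :: "'b::field_char_0 alg_closure mat set"
    and n m :: nat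
    and \<phi> :: "'a mat \<Rightarrow> 'b mat"
  assumes "\<forall>d. \<forall>f :: 'a \<Rightarrow> 'b mat. nonunital_ring_hom_mat d f \<longrightarrow> f = (\<lambda>_. 0\<^sub>m d d)"
    and "unipotent_algebraic_group n U"
    and "unipotent_algebraic_group m V"
    and "\<phi> \<in> hom (rational_points n U) (rational_points m V)"
  shows "comm_group ((rational_points m V)\<lparr>carrier := \<phi> ` carrier (rational_points n U)\<rparr>)"
proof -
  define G where "G = carrier (rational_points n U)"
  define H where "H = carrier (rational_points m V)"
  interpret G: group "rational_points n U"
    by (rule group_rational_points)
      (use assms(2) in \<open>simp add: unipotent_algebraic_group_def linear_algebraic_group_def\<close>)
  interpret H: group "rational_points m V"
    by (rule group_rational_points)
      (use assms(3) in \<open>simp add: unipotent_algebraic_group_def linear_algebraic_group_def\<close>)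
  interpret phi: group_hom "rational_points n U" "rational_points m V" \<phi>
    by (intro group_hom.intro group_hom_axioms.intro G.is_group H.is_group assms(4))
  have Gm: "g \<in> carrier_mat n n" if "g \<in> G" for g
    using rational_point_carrier_mat that unfolding G_def .
  have Hm: "h \<in> carrier_mat m m" if "h \<in> H" for h
    using rational_point_carrier_mat that unfolding H_def .
  have G_mult: "g * h \<in> G" if "g \<in> G" "h \<in> G" for g h
    using G.m_closed[of g h] that by (simp add: G_def)
  have H_mult: "g * h \<in> H" if "g \<in> H" "h \<in> H" for g h
    using H.m_closed[of g h] that by (simp add: H_def)
  have phi_in: "\<phi> g \<in> H" if "g \<in> G" for g
    using phi.hom_closed[of g] that by (simp add: G_def H_def)
  have phi_mult: "\<phi> (g * h) = \<phi> g * \<phi> h" if "g \<in> G" "h \<in> G" for g h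
    using phi.hom_mult[of g h] that by (simp add: G_def)
  have phi_one: "\<phi> (1\<^sub>m n) = 1\<^sub>m m" using phi.hom_one by simp
  have one_G: "1\<^sub>m n \<in> G" using G.one_closed by (simp add: G_def)
  have phi_pow: "g ^\<^sub>m k \<in> G \<and> \<phi> (g ^\<^sub>m k) = \<phi> g ^\<^sub>m k" if g: "g \<in> G" for g k
  proof (induction k)
    case 0
    show ?case using Gm[OF g] Hm[OF phi_in[OF g]] one_G phi_one by simp
  next
    case (Suc k)
    then show ?case using G_mult[of "g ^\<^sub>m k" g] phi_mult[of "g ^\<^sub>m k" g] g by simp
  qed
  define F1 where "F1 = lin.ideal_power (augmentation n G)"
  define F2 where "F2 = lin.ideal_power (augmentation m H)"
  obtain c1 where c1: "\<And>d. c1 \<le> d \<Longrightarrow> nilpotent_filtration F1 d"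
    using unipotent_group_filtration[OF rational_point_unipotent[OF assms(2)] G_mult, folded G_def]
    unfolding F1_def by blast
  obtain c2 where c2: "\<And>d. c2 \<le> d \<Longrightarrow> nilpotent_filtration F2 d"
    using unipotent_group_filtration[OF rational_point_unipotent[OF assms(3)] H_mult, folded H_def]
    unfolding F2_def by blast
  define d where "d = max c1 c2"
  have nf1: "nilpotent_filtration F1 d" and nf2: "nilpotent_filtration F2 d"
    using c1[of d] c2[of d] by (simp_all add: d_def)
  interpret F1: nilpotent_filtration F1 d by (rule nf1)
  interpret F2: nilpotent_filtration F2 d by (rule nf2)
  have F1_0: "F1 0 = augmentation n G" and F2_0: "F2 0 = augmentation m H"
    by (simp_all add: F1_def F2_def)
  have scale_F1: "scale_lin t x \<in> F1 0" if "x \<in> F1 0" for t x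
    using that unfolding F1_0 augmentation_def by (rule lin.span_scale)
  have log1: "\<exists>x \<in> F1 0. nexp d x = unit_lin n g" if "g \<in> G" for g
  proof -
    have "lin_of_mat (g - 1\<^sub>m n) \<in> F1 0"
      unfolding F1_0 augmentation_def using that by (intro lin.span_base) blast
    from F1.log_exists[OF this] show ?thesis by (auto simp: unit_lin_def)
  qed
  have log2: "\<exists>x \<in> F2 0. nexp d x = unit_lin m g" if "g \<in> H" for g
  proof -
    have "lin_of_mat (g - 1\<^sub>m m) \<in> F2 0"
      unfolding F2_0 augmentation_def using that by (intro lin.span_base) blast
    from F2.log_exists[OF this] show ?thesis by (auto simp: unit_lin_def)
  qed
  have scale_log: "\<exists>h \<in> G. nexp d (scale_lin t x) = unit_lin n h"
    if "x \<in> F1 0" "g \<in> G" "nexp d x = unit_lin n g" for t x g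
    using rational_points_log_scale[OF assms(2), folded G_def, folded F1_def, OF nf1] that
    unfolding F1_0 by blast
  define \<Gamma> where "\<Gamma> = (\<lambda>g. (unit_lin n g, unit_lin m (\<phi> g))) ` G"
  define F where "F k = F1 k \<times> F2 k" for k
  have nf: "nilpotent_filtration F d"
    unfolding F_def by (rule nilpotent_filtration_prod[OF nf1 nf2])
  interpret divisible_unipotent_group F d \<Gamma>
  proof (intro divisible_unipotent_group.intro divisible_unipotent_group_axioms.intro nf)
    show "1 \<in> \<Gamma>"
      unfolding \<Gamma>_def by (rule rev_image_eqI[OF one_G]) (simp add: phi_one one_prod_def)
  next
    fix g h assume "g \<in> \<Gamma>" "h \<in> \<Gamma>"
    then obtain a b where "a \<in> G" "b \<in> G" "g = (unit_lin n a, unit_lin m (\<phi> a))"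
      "h = (unit_lin n b, unit_lin m (\<phi> b))" by (auto simp: \<Gamma>_def)
    then show "g * h \<in> \<Gamma>"
      unfolding \<Gamma>_def using phi_in
      by (intro rev_image_eqI[OF G_mult[of a b]])
        (auto simp: times_prod_def unit_lin_mult Gm Hm phi_mult)
  next
    fix g assume "g \<in> \<Gamma>"
    then obtain a where a: "a \<in> G" "g = (unit_lin n a, unit_lin m (\<phi> a))" by (auto simp: \<Gamma>_def)
    define b where "b = inv\<^bsub>rational_points n U\<^esub> a"
    have b: "b \<in> G" "a * b = 1\<^sub>m n"
      using a(1) G.inv_closed[of a] G.r_inv[of a] by (simp_all add: G_def b_def)
    have "g * (unit_lin n b, unit_lin m (\<phi> b)) = (unit_lin n (a * b), unit_lin m (\<phi> (a * b)))"
      using a b(1) phi_in by (simp add: times_prod_def unit_lin_mult Gm Hm phi_mult)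
    then have "g * (unit_lin n b, unit_lin m (\<phi> b)) = 1" by (simp add: b(2) phi_one one_prod_def)
    then show "\<exists>h \<in> \<Gamma>. g * h = 1" using b(1) by (auto simp: \<Gamma>_def)
  next
    fix x and k :: nat assume x: "x \<in> F 0" "nexp d x \<in> \<Gamma>" and k: "0 < k"
    obtain x1 x2 where x12: "x = (x1, x2)" "x1 \<in> F1 0" "x2 \<in> F2 0" using x(1) by (auto simp: F_def)
    obtain g where g: "g \<in> G" "nexp d x1 = unit_lin n g" "nexp d x2 = unit_lin m (\<phi> g)"
      using x(2) by (auto simp: \<Gamma>_def x12 nexp_Pair)
    define y where "y = (1 / of_nat k) *q x1"
    obtain h where h: "h \<in> G" "nexp d y = unit_lin n h"
      using scale_log[OF x12(2) g(1,2), of "of_rat (1 / of_nat k)"] by (auto simp: y_def qscale_lin_def)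
    have y: "y \<in> F1 0" unfolding y_def using x12(2) by (rule Q.subspace_scale[OF F1.subspace])
    \<comment> \<open>A root of \<open>g\<close> is mapped to a root of \<open>\<phi> g\<close>, and in characteristic 0 unipotent matrices have unique unipotent roots.\<close>
    have "unit_lin n (h ^\<^sub>m k) = unit_lin n g"
      using F1.nexp_of_nat_scale[OF y, of k] k
      by (simp add: unit_lin_pow[OF Gm[OF h(1)]] h(2)[symmetric] g(2)[symmetric] y_def)
    then have hk: "h ^\<^sub>m k = g" using unit_lin_inject phi_pow[OF h(1)] g(1) Gm by blast
    obtain z where z: "z \<in> F2 0" "nexp d z = unit_lin m (\<phi> h)" using log2[OF phi_in[OF h(1)]] by blast
    have "nexp d (of_nat k *q z) = unit_lin m (\<phi> h ^\<^sub>m k)"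
      by (simp add: F2.nexp_of_nat_scale[OF z(1)] z(2) unit_lin_pow[OF Hm[OF phi_in[OF h(1)]]])
    also have "\<dots> = nexp d x2" using phi_pow[OF h(1), of k] by (simp add: hk g(3))
    finally have "of_nat k *q z = x2"
      by (rule F2.nexp_inj[OF Q.subspace_scale[OF F2.subspace z(1)] x12(3)])
    then have "z = (1 / of_nat k) *q x2" using k by auto
    then have "(1 / of_nat k) *q x = (y, z)" by (simp add: qscale_prod_def x12(1) y_def)
    then show "nexp d ((1 / of_nat k) *q x) \<in> \<Gamma>"
      using h z by (auto simp: \<Gamma>_def nexp_Pair)
  qed
  have log_iff: "(x, Z) \<in> log_set \<longleftrightarrow> x \<in> F1 0 \<and> Z \<in> F2 0 \<and>
      (\<exists>g \<in> G. nexp d x = unit_lin n g \<and> nexp d Z = unit_lin m (\<phi> g))" for x Z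
    unfolding log_set_def by (auto simp: F_def \<Gamma>_def nexp_Pair)
  \<comment> \<open>So the logarithms of the graph are the graph of a map \<open>D\<close>, the differential of \<open>\<phi>\<close>.\<close>
  have functional: "Z = Y" if Z: "(x, Z) \<in> log_set" and Y: "(x, Y) \<in> log_set" for x Z Y
  proof -
    obtain g where g: "g \<in> G" "nexp d x = unit_lin n g" "nexp d Z = unit_lin m (\<phi> g)"
      using Z unfolding log_iff by blast
    obtain h where h: "h \<in> G" "nexp d x = unit_lin n h" "nexp d Y = unit_lin m (\<phi> h)"
      using Y unfolding log_iff by blast
    have "g = h" using unit_lin_inject[OF Gm[OF g(1)] Gm[OF h(1)]] g(2) h(2) by simp
    then show ?thesis using F2.nexp_inj[of Z Y] Z Y g(3) h(3) by (simp add: log_iff)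
  qed
  define L where "L = Domain log_set"
  define D where "D x = (THE Z. (x, Z) \<in> log_set)" for x
  have D: "(x, D x) \<in> log_set" if "x \<in> L" for x
    using that functional unfolding L_def D_def by (auto intro: theI)
  have D_eq: "D x = Z" if "(x, Z) \<in> log_set" for x Z
    using D[of x] that functional by (auto simp: L_def)
  have L_exp: "x \<in> L" if "x \<in> F1 0" "g \<in> G" "nexp d x = unit_lin n g" for x g
  proof -
    obtain Z where "Z \<in> F2 0" "nexp d Z = unit_lin m (\<phi> g)" using log2[OF phi_in[OF \<open>g \<in> G\<close>]] by blast
    then have "(x, Z) \<in> log_set" using that unfolding log_iff by blast
    then show ?thesis by (auto simp: L_def)
  qed
  have L_scale: "scale_lin t x \<in> L" if x: "x \<in> L" for t x
  proof -
    obtain g where g: "x \<in> F1 0" "g \<in> G" "nexp d x = unit_lin n g"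
      using D[OF x] unfolding log_iff by blast
    from scale_log[OF g, of t] show ?thesis using L_exp scale_F1[OF g(1)] by blast
  qed
  have D_bracket: "D (x * y - y * x) = D x * D y - D y * D x" if "x \<in> L" "y \<in> L" for x y
  proof -
    from log_set_bracket[OF D[OF that(2)] D[OF that(1)]]
    have "(x * y - y * x, D x * D y - D y * D x) \<in> log_set" by (simp add: times_prod_def)
    then show ?thesis by (rule D_eq)
  qed
  \<comment> \<open>Both sides are \<open>D (t [x, y])\<close>, by bilinearity of the bracket over the first field.\<close>
  have D_balanced: "D (scale_lin t x) * D y - D y * D (scale_lin t x) =
      D x * D (scale_lin t y) - D (scale_lin t y) * D x" if "x \<in> L" "y \<in> L" for t x y
    using D_bracket[OF L_scale[OF that(1), of t] that(2)] D_bracket[OF that(1) L_scale[OF that(2), of t]]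
    by (simp add: lin.mult_scale_left lin.mult_scale_right)
  have D_add: "D (scale_lin (s + t) x) = D (scale_lin s x) + D (scale_lin t x)" if "x \<in> L" for s t x
  proof -
    from Q.subspace_add[OF log_set_subspace D[OF L_scale[OF that, of s]] D[OF L_scale[OF that, of t]]]
    have "(scale_lin (s + t) x, D (scale_lin s x) + D (scale_lin t x)) \<in> log_set"
      by (simp add: lin.scale_left_distrib)
    then show ?thesis by (rule D_eq)
  qed
  obtain S where S: "finite S" "lin_of_mat ` carrier_mat m m \<subseteq> (lin.span S :: 'b lin set)"
    using lin_of_mat_span by blast
  have "D ` L \<subseteq> lin.span S"
  proof clarify
    fix x assume "x \<in> L"
    then have "D x \<in> augmentation m H" using D[of x] by (simp add: log_iff F2_0)
    then obtain A where "A \<in> carrier_mat m m" "D x = lin_of_mat A"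
      using augmentation_mat[OF rational_point_unipotent[OF assms(3)]] unfolding H_def by blast
    then show "D x \<in> lin.span S" using S(2) by blast
  qed
  then have D_commute: "D x * D y = D y * D x" if "x \<in> L" "y \<in> L" for x y
    using lin.balanced_family_commutes[of S D L scale_lin x y] assms(1) S(1) L_scale D_add D_balanced that
    by (simp add: mult.commute)
  have phi_commute: "\<phi> g * \<phi> h = \<phi> h * \<phi> g" if gh: "g \<in> G" "h \<in> G" for g h
  proof -
    have log_phi: "\<exists>x \<in> L. D x \<in> F2 0 \<and> nexp d (D x) = unit_lin m (\<phi> g)" if "g \<in> G" for g
    proof -
      obtain x where x: "x \<in> F1 0" "nexp d x = unit_lin n g" using log1[OF \<open>g \<in> G\<close>] by blast
      then have "x \<in> L" using L_exp that by blast
      moreover obtain g' where g': "g' \<in> G" "nexp d x = unit_lin n g'" "nexp d (D x) = unit_lin m (\<phi> g')"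
        "D x \<in> F2 0"
        using D[OF \<open>x \<in> L\<close>] unfolding log_iff by blast
      moreover have "g' = g" using unit_lin_inject[OF Gm[OF g'(1)] Gm[OF that]] g'(2) x(2) by simp
      ultimately show ?thesis by blast
    qed
    obtain x where x: "x \<in> L" "D x \<in> F2 0" "nexp d (D x) = unit_lin m (\<phi> g)"
      using log_phi[OF gh(1)] by blast
    obtain y where y: "y \<in> L" "D y \<in> F2 0" "nexp d (D y) = unit_lin m (\<phi> h)"
      using log_phi[OF gh(2)] by blast
    have "unit_lin m (\<phi> g) * unit_lin m (\<phi> h) = unit_lin m (\<phi> h) * unit_lin m (\<phi> g)"
      using F2.nexp_commute[OF x(2) y(2) D_commute[OF x(1) y(1)]] by (simp only: x(3) y(3))
    moreover have "\<phi> g \<in> carrier_mat m m" "\<phi> h \<in> carrier_mat m m" using gh phi_in Hm by auto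
    ultimately show ?thesis
      using unit_lin_inject[of "\<phi> g * \<phi> h" m "\<phi> h * \<phi> g"] by (simp add: unit_lin_mult)
  qed
  have "group ((rational_points m V)\<lparr>carrier := \<phi> ` carrier (rational_points n U)\<rparr>)"
    by (rule H.subgroup_imp_group[OF phi.img_is_subgroup])
  then show ?thesis
    by (rule group.group_comm_groupI) (use phi_commute in \<open>auto simp: G_def\<close>)
qed

end
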